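(* Let $\Sigma\subset\mathbb{T}$ be a globally convex congruence with curvature $K$. Then $$\int_\Sigma K\,d\mu=4\pi,$$ where $d\mu$ at $\gamma\in\Sigma$ is the pull-back to $T_\gamma\Sigma$ of the area form induced by the Euclidean metric of $\mathbb{R}^3$ on the plane orthogonal to $\gamma$, and where for each $\gamma$ both $K$ and $d\mu$ are evaluated at one and the same point of $\gamma$, which may be any point of $\gamma$ with $\Delta\neq0$.
   Context: Oriented lines. The space of oriented lines in $\mathbb{R}^3$ is $\mathbb{T}=\{(\vec U,\vec W)\in\mathbb{R}^3\times\mathbb{R}^3 : \langle\vec U,\vec W\rangle=0,\ |\vec W|=1\}\cong TS^2=T\mathbb{P}^1$; the pair $(\vec U,\vec W)$ is the oriented line $\{\vec U+r\vec W: r\in\mathbb{R}\}$, and $\pi(\vec U,\vec W)=\vec W\in S^2=\mathbb{P}^1$. A line congruence is a smooth (immersed) real surface $\Sigma\subset\mathbb{T}$. It is globally convex if it is the graph of a global smooth section of $\pi:\mathbb{T}\to\mathbb{P}^1$; it is then oriented so that $\pi|_\Sigma:\Sigma\to\mathbb{P}^1$ is orientation preserving for the complex orientation of $\mathbb{P}^1$ given by the coordinate $\xi$ below. Coordinates. On $\mathbb{R}^3$ put $z=x^1+ix^2$, $t=x^3$. Let $\xi$ be the holomorphic coordinate on $\mathbb{P}^1=S^2$ given by stereographic projection from the South pole (so $\vec W$ has $z$-component $\frac{2\xi}{1+\xi\bar\xi}$ and $t$-component $\frac{1-\xi\bar\xi}{1+\xi\bar\xi}$). The point $F\frac{\partial}{\partial\xi}\in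 T_\xi\mathbb{P}^1$ has coordinates $(\xi,F)$ and corresponds to the oriented line, parametrised by arclength $r$, $$z=\frac{2(F-\bar F\xi^2)+2\xi(1+\xi\bar\xi)r}{(1+\xi\bar\xi)^2},\qquad t=\frac{-2(F\bar\xi+\bar F\xi)+(1-\xi^2\bar\xi^2)r}{(1+\xi\bar\xi)^2}.$$ A congruence is locally parametrised by smooth functions $\xi(u,v),F(u,v)$ of real parameters $u,v$; substituting these gives a map $\Phi(u,v,r)\in\mathbb{R}^3$. (Lines in the South pole direction are treated after a rotation of $\mathbb{R}^3$.) Put $\nu=u+iv$, $\partial=\partial/\partial\nu$, $\bar\partial=\partial/\partial\bar\nu$, and $$\partial^+F=\partial F+r\,\partial\xi-\frac{2F\bar\xi\,\partial\xi}{1+\xi\bar\xi},\qquad \partial^-F=\bar\partial F+r\,\bar\partial\xi-\frac{2F\bar\xi\,\bar\partial\xi}{1+\xi\bar\xi},$$ $$\Delta=\frac{4}{(1+\xi\bar\xi)^2}\left(\partial^+F\,\overline{\partial^+F}-\partial^-F\,\overline{\partial^-F}\right).$$ Curvature. At points $(u,v,r)$ with $\Delta\neq0$ set $$\rho=\frac{\partial^+F\,\bar\partial\bar\xi-\partial^-F\,\partial\bar\xi}{\partial^-F\,\overline{\partial^-F}-\partial^+F\,\overline{\partial^+F}},\qquad \sigma=\frac{\overline{\partial^+F}\,\partial\bar\xi-\overline{\partial^-F}\,\bar\partial\bar\xi}{\partial^-F\,\overline{\partial^-F}-\partial^+F\,\overline{\partial^+F}},$$ and $K=\rho\bar\rho-\sigma\bar\sigma$.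 The form $d\mu$. Let $\gamma\in\Sigma$ have parameters $(u,v)$ and choose a point of $\gamma$ with parameter $r$. The plane $\gamma^\perp$ orthogonal to $\gamma$ is oriented so that (direction of $\gamma$, positive basis of $\gamma^\perp$) is positively oriented in $\mathbb{R}^3$. Then $d\mu$ at $\gamma$ is the (signed) 2-form on $T_\gamma\Sigma$ obtained by pulling back the oriented Euclidean area form of $\gamma^\perp$ under the linear map $a\,\partial_u+b\,\partial_v\mapsto$ orthogonal projection onto $\gamma^\perp$ of $a\,\Phi_u(u,v,r)+b\,\Phi_v(u,v,r)$. *)

theory Defs
  imports "HOL-Analysis.Analysis"
begin

section \<open>Smooth maps\<close>

fun Ck_on :: "nat \<Rightarrow> 'a::euclidean_space set \<Rightarrow> ('a \<Rightarrow> 'b::euclidean_space) \<Rightarrow> bool" where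
  "Ck_on 0 S f = continuous_on S f"
| "Ck_on (Suc k) S f =
     ((\<forall>x\<in>S. f differentiable (at x)) \<and>
      (\<forall>v. Ck_on k S (\<lambda>x. frechet_derivative f (at x) v)))"

text \<open>Only used for open sets \<open>S\<close>.\<close>

definition smooth_on :: "'a::euclidean_space set \<Rightarrow> ('a \<Rightarrow> 'b::euclidean_space) \<Rightarrow> bool" where
  "smooth_on S f \<longleftrightarrow> (\<forall>k. Ck_on k S f)"

text \<open>Smoothness on an arbitrary subset of Euclidean space, here an embedded submanifold:
  local existence of smooth extensions to open sets.\<close>

definition smooth_map_on :: "'a::euclidean_space set \<Rightarrow> ('a \<Rightarrow> 'b::euclidean_space) \<Rightarrow> bool" where
  "smooth_map_on X f \<longleftrightarrow>
     (\<forall>x\<in>X. \<exists>N g. open N \<and> x \<in> N \<and> smooth_on N g \<and> (\<forall>y\<in>N \<inter> X. g y = f y))"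


section \<open>Oriented lines and globally convex congruences\<close>

text \<open>\<open>(U, W)\<close> is the line \<open>{U + r W | r}\<close> oriented by \<open>W\<close>.\<close>

type_synonym line = "(real^3) \<times> (real^3)"

definition oriented_lines :: "line set" where
  "oriented_lines = {(U, W). U \<bullet> W = 0 \<and> norm W = 1}"

definition globally_convex :: "line set \<Rightarrow> bool" where
  "globally_convex \<Sigma> \<longleftrightarrow>
     (\<exists>s. smooth_map_on (sphere 0 1) s \<and>
          (\<forall>W\<in>sphere 0 1. (s W, W) \<in> oriented_lines) \<and>
          \<Sigma> = (\<lambda>W. (s W, W)) ` sphere 0 1)"


section \<open>The coordinates \<open>(\<xi>, F)\<close>\<close>

definition line_z :: "complex \<Rightarrow> complex \<Rightarrow> real \<Rightarrow> complex" where
  "line_z \<xi> F r =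
     (2 * (F - cnj F * \<xi>^2) + 2 * \<xi> * (1 + \<xi> * cnj \<xi>) * of_real r) / (1 + \<xi> * cnj \<xi>)^2"

text \<open>The quotient below is real; \<open>Re\<close> only changes its type.\<close>

definition line_t :: "complex \<Rightarrow> complex \<Rightarrow> real \<Rightarrow> real" where
  "line_t \<xi> F r =
     Re ((- 2 * (F * cnj \<xi> + cnj F * \<xi>) + (1 - \<xi>^2 * (cnj \<xi>)^2) * of_real r)
         / (1 + \<xi> * cnj \<xi>)^2)"

definition line_point :: "complex \<Rightarrow> complex \<Rightarrow> real \<Rightarrow> real^3" where
  "line_point \<xi> F r = vector [Re (line_z \<xi> F r), Im (line_z \<xi> F r), line_t \<xi> F r]"

definition line_direction :: "complex \<Rightarrow> real^3" where
  "line_direction \<xi> =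
     vector [Re (2 * \<xi> / (1 + \<xi> * cnj \<xi>)), Im (2 * \<xi> / (1 + \<xi> * cnj \<xi>)),
             Re ((1 - \<xi> * cnj \<xi>) / (1 + \<xi> * cnj \<xi>))]"

text \<open>\<open>line_point \<xi> F r = line_point \<xi> F 0 + r *\<^sub>R line_direction \<xi>\<close>, and the vector
  \<open>line_point \<xi> F 0\<close> is orthogonal to the direction.  The coordinates cover all oriented lines
  except those in the South pole direction.\<close>

definition line_of :: "complex \<Rightarrow> complex \<Rightarrow> line" where
  "line_of \<xi> F = (line_point \<xi> F 0, line_direction \<xi>)"

definition south_pole :: "real^3" where
  "south_pole = vector [0, 0, -1]"


section \<open>Local parametrisations and curvature\<close>

text \<open>The real parameters \<open>(u, v)\<close> are encoded as \<open>\<nu> = u + \<i> v\<close>, so that the tangent vector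
  \<open>a \<partial>\<^sub>u + b \<partial>\<^sub>v\<close> is the complex number \<open>a + \<i> b\<close>.\<close>

definition d_nu :: "(complex \<Rightarrow> complex) \<Rightarrow> complex \<Rightarrow> complex" where
  "d_nu f \<nu> = (frechet_derivative f (at \<nu>) 1 - \<i> * frechet_derivative f (at \<nu>) \<i>) / 2"

definition d_nubar :: "(complex \<Rightarrow> complex) \<Rightarrow> complex \<Rightarrow> complex" where
  "d_nubar f \<nu> = (frechet_derivative f (at \<nu>) 1 + \<i> * frechet_derivative f (at \<nu>) \<i>) / 2"

text \<open>The last condition says that the Jacobian determinant of \<open>\<xi>\<close> is positive, i.e. that the
  projection to the direction sphere, with its complex orientation, preserves orientation.  It
  also makes the parametrisation an immersion.\<close>

definition oriented_param ::
    "line set \<Rightarrow> complex set \<Rightarrow> (complex \<Rightarrow> complex) \<Rightarrow> (complex \<Rightarrow> complex) \<Rightarrow> bool" where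
  "oriented_param \<Sigma> D \<xi> F \<longleftrightarrow>
     open D \<and> smooth_on D \<xi> \<and> smooth_on D F \<and>
     (\<forall>\<nu>\<in>D. line_of (\<xi> \<nu>) (F \<nu>) \<in> \<Sigma>) \<and>
     inj_on (\<lambda>\<nu>. line_of (\<xi> \<nu>) (F \<nu>)) D \<and>
     (\<forall>\<nu>\<in>D. (cmod (d_nu \<xi> \<nu>))^2 - (cmod (d_nubar \<xi> \<nu>))^2 > 0)"

definition dplus ::
    "(complex \<Rightarrow> complex) \<Rightarrow> (complex \<Rightarrow> complex) \<Rightarrow> complex \<Rightarrow> real \<Rightarrow> complex" where
  "dplus \<xi> F \<nu> r = d_nu F \<nu> + of_real r * d_nu \<xi> \<nu>
     - 2 * F \<nu> * cnj (\<xi> \<nu>) * d_nu \<xi> \<nu> / (1 + \<xi> \<nu> * cnj (\<xi> \<nu>))"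

definition dminus ::
    "(complex \<Rightarrow> complex) \<Rightarrow> (complex \<Rightarrow> complex) \<Rightarrow> complex \<Rightarrow> real \<Rightarrow> complex" where
  "dminus \<xi> F \<nu> r = d_nubar F \<nu> + of_real r * d_nubar \<xi> \<nu>
     - 2 * F \<nu> * cnj (\<xi> \<nu>) * d_nubar \<xi> \<nu> / (1 + \<xi> \<nu> * cnj (\<xi> \<nu>))"

definition Delta ::
    "(complex \<Rightarrow> complex) \<Rightarrow> (complex \<Rightarrow> complex) \<Rightarrow> complex \<Rightarrow> real \<Rightarrow> complex" where
  "Delta \<xi> F \<nu> r = 4 / (1 + \<xi> \<nu> * cnj (\<xi> \<nu>))^2 *
     (dplus \<xi> F \<nu> r * cnj (dplus \<xi> F \<nu> r) - dminus \<xi> F \<nu> r * cnj (dminus \<xi> F \<nu> r))"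

definition rho ::
    "(complex \<Rightarrow> complex) \<Rightarrow> (complex \<Rightarrow> complex) \<Rightarrow> complex \<Rightarrow> real \<Rightarrow> complex" where
  "rho \<xi> F \<nu> r =
     (dplus \<xi> F \<nu> r * d_nubar (\<lambda>w. cnj (\<xi> w)) \<nu> - dminus \<xi> F \<nu> r * d_nu (\<lambda>w. cnj (\<xi> w)) \<nu>)
     / (dminus \<xi> F \<nu> r * cnj (dminus \<xi> F \<nu> r) - dplus \<xi> F \<nu> r * cnj (dplus \<xi> F \<nu> r))"

definition sigma ::
    "(complex \<Rightarrow> complex) \<Rightarrow> (complex \<Rightarrow> complex) \<Rightarrow> complex \<Rightarrow> real \<Rightarrow> complex" where
  "sigma \<xi> F \<nu> r =
     (cnj (dplus \<xi> F \<nu> r) * d_nu (\<lambda>w. cnj (\<xi> w)) \<nu>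
       - cnj (dminus \<xi> F \<nu> r) * d_nubar (\<lambda>w. cnj (\<xi> w)) \<nu>)
     / (dminus \<xi> F \<nu> r * cnj (dminus \<xi> F \<nu> r) - dplus \<xi> F \<nu> r * cnj (dplus \<xi> F \<nu> r))"

definition curvature ::
    "(complex \<Rightarrow> complex) \<Rightarrow> (complex \<Rightarrow> complex) \<Rightarrow> complex \<Rightarrow> real \<Rightarrow> real" where
  "curvature \<xi> F \<nu> r =
     Re (rho \<xi> F \<nu> r * cnj (rho \<xi> F \<nu> r) - sigma \<xi> F \<nu> r * cnj (sigma \<xi> F \<nu> r))"

text \<open>Whether \<open>\<Delta> \<noteq> 0\<close> holds at the point with arclength parameter \<open>r\<close> of the line \<open>\<gamma>\<close> does not
  depend on the parametrisation.  Nothing is required of the line in the South pole direction.\<close>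

definition nonfocal :: "line set \<Rightarrow> line \<Rightarrow> real \<Rightarrow> bool" where
  "nonfocal \<Sigma> \<gamma> r \<longleftrightarrow>
     (\<forall>D \<xi> F \<nu>. oriented_param \<Sigma> D \<xi> F \<and> \<nu> \<in> D \<and> line_of (\<xi> \<nu>) (F \<nu>) = \<gamma>
        \<longrightarrow> Delta \<xi> F \<nu> r \<noteq> 0)"


section \<open>The form \<open>d\<mu>\<close> and integration over a congruence\<close>

text \<open>Area form of the plane orthogonal to the unit vector \<open>W\<close>, oriented so that \<open>W\<close> followed by a
  positive basis of the plane is positive: the contraction of the volume form of \<open>\<real>\<^sup>3\<close> with
  \<open>W\<close>.\<close>

definition perp_area_form :: "real^3 \<Rightarrow> real^3 \<Rightarrow> real^3 \<Rightarrow> real" where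
  "perp_area_form W X Y = det (vector [W, X, Y] :: real^3^3)"

definition perp_proj :: "real^3 \<Rightarrow> real^3 \<Rightarrow> real^3" where
  "perp_proj W X = X - (X \<bullet> W) *\<^sub>R W"

definition dPhi ::
    "(complex \<Rightarrow> complex) \<Rightarrow> (complex \<Rightarrow> complex) \<Rightarrow> complex \<Rightarrow> real \<Rightarrow> complex \<Rightarrow> real^3" where
  "dPhi \<xi> F \<nu> r h = frechet_derivative (\<lambda>w. line_point (\<xi> w) (F w) r) (at \<nu>) h"

definition dmu ::
    "(complex \<Rightarrow> complex) \<Rightarrow> (complex \<Rightarrow> complex) \<Rightarrow> complex \<Rightarrow> real
      \<Rightarrow> complex \<Rightarrow> complex \<Rightarrow> real" where
  "dmu \<xi> F \<nu> r h k =
     (let W = line_direction (\<xi> \<nu>)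
      in perp_area_form W (perp_proj W (dPhi \<xi> F \<nu> r h)) (perp_proj W (dPhi \<xi> F \<nu> r k)))"

text \<open>A 2-form on a congruence is given by its expression \<open>\<omega> \<xi> F \<nu> h k\<close> in each oriented
  parametrisation \<open>(\<xi>, F)\<close>, at the parameter \<open>\<nu>\<close>, on the tangent vectors \<open>h\<close> and \<open>k\<close>.\<close>

type_synonym form2 =
  "(complex \<Rightarrow> complex) \<Rightarrow> (complex \<Rightarrow> complex) \<Rightarrow> complex \<Rightarrow> complex \<Rightarrow> complex \<Rightarrow> real"

text \<open>A partition of \<open>\<Sigma>\<close> into countably many measurable pieces, each inside the image of an oriented
  parametrisation.  The only possible line of a graph not covered is the one in the South pole
  direction; a single point of the surface is a null set.\<close>

definition parametrised_partition ::
    "line set \<Rightarrow> (nat \<Rightarrow> complex set) \<Rightarrow> (nat \<Rightarrow> complex \<Rightarrow> complex) \<Rightarrow> (nat \<Rightarrow> complex \<Rightarrow> complex)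
      \<Rightarrow> (nat \<Rightarrow> complex set) \<Rightarrow> bool" where
  "parametrised_partition \<Sigma> D \<xi> F A \<longleftrightarrow>
     (\<forall>i. oriented_param \<Sigma> (D i) (\<xi> i) (F i) \<and> A i \<subseteq> D i \<and> A i \<in> sets lebesgue) \<and>
     disjoint_family (\<lambda>i. (\<lambda>\<nu>. line_of (\<xi> i \<nu>) (F i \<nu>)) ` A i) \<and>
     (\<Union>i. (\<lambda>\<nu>. line_of (\<xi> i \<nu>) (F i \<nu>)) ` A i) = {\<gamma>\<in>\<Sigma>. snd \<gamma> \<noteq> south_pole}"

text \<open>The value \<open>\<omega> \<xi> F \<nu> 1 \<i>\<close> is the coefficient of \<open>du \<and> dv\<close>.  The
  integral has to exist and to be the same for all partitions.\<close>

definition has_form_integral :: "line set \<Rightarrow> form2 \<Rightarrow> real \<Rightarrow> bool" where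
  "has_form_integral \<Sigma> \<omega> I \<longleftrightarrow>
     (\<exists>D \<xi> F A. parametrised_partition \<Sigma> D \<xi> F A) \<and>
     (\<forall>D \<xi> F A. parametrised_partition \<Sigma> D \<xi> F A \<longrightarrow>
        (\<forall>i. (\<lambda>\<nu>. \<omega> (\<xi> i) (F i) \<nu> 1 \<i>) absolutely_integrable_on A i) \<and>
        summable (\<lambda>i. integral (A i) (\<lambda>\<nu>. \<bar>\<omega> (\<xi> i) (F i) \<nu> 1 \<i>\<bar>)) \<and>
        (\<lambda>i. integral (A i) (\<lambda>\<nu>. \<omega> (\<xi> i) (F i) \<nu> 1 \<i>)) sums I)"

end

theory Submission
  imports Defs
begin

text \<open>For a globally convex congruence the theorem is an analogue of the statement that a convex surface has
total Gauss curvature \<open>4 * pi\<close>: the direction map from the congruence to the sphere plays the role of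
the Gauss map, and it is a diffeomorphism because the congruence is a graph.

Let \<open>J\<close> be the Jacobian of \<open>\<xi>\<close> in the parameters, and let \<open>d\<close> be the difference of the squared
moduli of \<open>dplus\<close> and \<open>dminus\<close>.  Moving along the congruence displaces the point at arclength \<open>r\<close>;
its displacement, projected to the plane orthogonal to the line, is the tangent vector of the sphere with
coordinate \<open>dplus * h + dminus * cnj h\<close> (\<open>line_point_has_derivative\<close>).  The determinant of this
map is \<open>d\<close>, and stereographic projection is conformal with factor \<open>2 / (1 + \<bar>\<xi>\<bar>\<^sup>2)\<close>, so the
form \<open>d\<mu>\<close> is \<open>4 * d / (1 + \<bar>\<xi>\<bar>\<^sup>2)\<^sup>2\<close> (\<open>dmu_eq\<close>).  On the other hand the curvature is
\<open>J / d\<close> (\<open>curvature_eq\<close>).  In the product \<open>d\<close> cancels: whichever nonfocal point is chosen on each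
line, the integrand is \<open>4 * J / (1 + \<bar>\<xi>\<bar>\<^sup>2)\<^sup>2\<close>, the pull-back of the area form of the sphere
(\<open>curvature_times_dmu\<close>).

Substituting \<open>z = \<xi> \<nu>\<close> turns the integral over a piece of any partition into the integral of
\<open>4 / (1 + \<bar>z\<bar>\<^sup>2)\<^sup>2\<close> over its set of directions (\<open>oriented_param_integral\<close>).  These sets are disjoint
and fill \<open>\<complex>\<close>, because the congruence is a graph over the sphere and the partition omits only the South
pole; so the pieces add up to the area of the sphere (\<open>spherical_density_has_integral\<close>).  Partitions
exist, since \<open>\<xi>\<close> itself is a global parameter (\<open>global_stereographic_param\<close>).\<close>

section \<open>Calculus of finitely often differentiable maps\<close>

lemma Ck_on_SucD:
  assumes "Ck_on (Suc k) S f" "x \<in> S"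
  shows "(f has_derivative frechet_derivative f (at x)) (at x)"
  using assms by (auto simp: frechet_derivative_works)

text \<open>On an open set \<open>S\<close> the derivative at a point depends on the values on \<open>S\<close> alone, and this repeats
at every order.\<close>

lemma Ck_on_cong:
  assumes "open S" "\<And>x. x \<in> S \<Longrightarrow> f x = g x" "Ck_on k S f"
  shows "Ck_on k S g"
  using assms(2,3)
proof (induction k arbitrary: f g)
  case 0
  then show ?case using continuous_on_cong[of S S f g] by auto
next
  case (Suc k)
  have diff: "f differentiable (at x)" if "x \<in> S" for x
    using Suc.prems(2) that by auto
  have "frechet_derivative f (at x) = frechet_derivative g (at x)" if "x \<in> S" for x
    using frechet_derivative_transform_within_open[OF diff[OF that] assms(1) that] Suc.prems(1)
    by blast
  then have "Ck_on k S (\<lambda>x. frechet_derivative g (at x) v)" for v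
    using Suc.IH[of "\<lambda>x. frechet_derivative f (at x) v"] Suc.prems(2) by simp
  moreover have "g differentiable (at x)" if "x \<in> S" for x
    using has_derivative_transform_within_open[OF _ assms(1) that] diff[OF that] Suc.prems(1)
    unfolding differentiable_def by blast
  ultimately show ?case by simp
qed

text \<open>The derivative rule for the inductions below: it replaces the chosen derivative \<open>frechet_derivative\<close> by
whatever formula the derivative rules produce.\<close>

lemma Ck_on_SucI:
  assumes "open S" "\<And>x. x \<in> S \<Longrightarrow> (f has_derivative f' x) (at x)"
    and "\<And>v. Ck_on k S (\<lambda>x. f' x v)"
  shows "Ck_on (Suc k) S f"
proof -
  have "f' x = frechet_derivative f (at x)" if "x \<in> S" for x
    using assms(2)[OF that] by (rule frechet_derivative_at)
  then have "Ck_on k S (\<lambda>x. frechet_derivative f (at x) v)" for v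
    by (intro Ck_on_cong[OF assms(1) _ assms(3)[of v]]) simp
  then show ?thesis
    using assms(2) by (auto simp: differentiable_def)
qed

lemma Ck_on_lower:
  assumes "Ck_on (Suc k) S f"
  shows "Ck_on k S f"
  using assms
proof (induction k arbitrary: f)
  case 0
  then have "f differentiable_on S"
    by (auto intro: differentiable_at_imp_differentiable_on)
  then show ?case by (simp add: differentiable_imp_continuous_on)
next
  case (Suc k)
  then show ?case by auto
qed

text \<open>A section of the sphere has smooth extensions near each point only, so smoothness of its pull-back has
to be glued from neighbourhoods.\<close>

lemma Ck_on_locally:
  assumes "\<And>x. x \<in> S \<Longrightarrow> \<exists>N. open N \<and> x \<in> N \<and> Ck_on k N f"
  shows "Ck_on k S f"
  using assms
proof (induction k arbitrary: f)
  case 0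
  have "isCont f x" if "x \<in> S" for x
    using 0[OF that] by (auto simp: continuous_on_eq_continuous_at)
  then show ?case by (simp add: continuous_at_imp_continuous_on)
next
  case (Suc k)
  have "f differentiable (at x)" if "x \<in> S" for x
    using Suc.prems[OF that] by auto
  moreover have "Ck_on k S (\<lambda>x. frechet_derivative f (at x) v)" for v
    using Suc.prems by (intro Suc.IH) (metis Ck_on.simps(2))
  ultimately show ?case by simp
qed

lemma Ck_on_const: "Ck_on k S (\<lambda>x. c)"
  by (induction k arbitrary: c) (auto simp: frechet_derivative_const)

lemma Ck_on_ident:
  assumes "open S"
  shows "Ck_on k S (\<lambda>x. x)"
proof (cases k)
  case (Suc l)
  show ?thesis
    unfolding Suc by (rule Ck_on_SucI[OF assms has_derivative_ident Ck_on_const])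
qed (auto intro: continuous_on_id)

lemma Ck_on_linear:
  assumes "open S" "bounded_linear L" "Ck_on k S f"
  shows "Ck_on k S (\<lambda>x. L (f x))"
  using assms(3)
proof (induction k arbitrary: f)
  case 0
  then show ?case using bounded_linear.continuous_on[OF assms(2)] by auto
next
  case (Suc k)
  show ?case
  proof (rule Ck_on_SucI[OF assms(1)])
    show "((\<lambda>x. L (f x)) has_derivative (\<lambda>v. L (frechet_derivative f (at x) v))) (at x)"
      if "x \<in> S" for x
      by (rule bounded_linear.has_derivative[OF assms(2) Ck_on_SucD[OF Suc.prems that]])
    show "Ck_on k S (\<lambda>x. L (frechet_derivative f (at x) v))" for v
      using Suc by simp
  qed
qed

lemma Ck_on_add:
  assumes "open S" "Ck_on k S f" "Ck_on k S g"
  shows "Ck_on k S (\<lambda>x. f x + g x)"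
  using assms(2,3)
proof (induction k arbitrary: f g)
  case 0
  then show ?case by (auto intro: continuous_on_add)
next
  case (Suc k)
  show ?case
  proof (rule Ck_on_SucI[OF assms(1)])
    show "((\<lambda>x. f x + g x) has_derivative
        (\<lambda>v. frechet_derivative f (at x) v + frechet_derivative g (at x) v)) (at x)"
      if "x \<in> S" for x
      using that Suc.prems by (intro has_derivative_add Ck_on_SucD)
    show "Ck_on k S (\<lambda>x. frechet_derivative f (at x) v + frechet_derivative g (at x) v)" for v
      using Suc by simp
  qed
qed

lemma Ck_on_bilinear:
  assumes "open S" "bounded_bilinear B" "Ck_on k S f" "Ck_on k S g"
  shows "Ck_on k S (\<lambda>x. B (f x) (g x))"
  using assms(3,4)
proof (induction k arbitrary: f g)
  case 0
  then show ?case using bounded_bilinear.continuous_on[OF assms(2)] by auto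
next
  case (Suc k)
  show ?case
  proof (rule Ck_on_SucI[OF assms(1)])
    show "((\<lambda>x. B (f x) (g x)) has_derivative
        (\<lambda>v. B (f x) (frechet_derivative g (at x) v) + B (frechet_derivative f (at x) v) (g x)))
        (at x)"
      if "x \<in> S" for x
      using that Suc.prems by (intro bounded_bilinear.FDERIV[OF assms(2)] Ck_on_SucD)
    show "Ck_on k S (\<lambda>x. B (f x) (frechet_derivative g (at x) v)
        + B (frechet_derivative f (at x) v) (g x))" for v
      using Suc.prems Ck_on_lower[OF Suc.prems(1)] Ck_on_lower[OF Suc.prems(2)]
      by (intro Ck_on_add[OF assms(1)] Suc.IH) simp_all
  qed
qed

lemma Ck_on_sum:
  assumes "open S" "finite I" "\<And>i. i \<in> I \<Longrightarrow> Ck_on k S (f i)"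
  shows "Ck_on k S (\<lambda>x. \<Sum>i\<in>I. f i x)"
  using assms(2,3)
proof (induction I)
  case empty
  show ?case by (simp add: Ck_on_const)
next
  case (insert i I)
  then show ?case using Ck_on_add[OF assms(1), of k "f i"] by simp
qed

lemma Ck_on_inverse:
  fixes n :: "'a::euclidean_space \<Rightarrow> real"
  assumes "open S" "Ck_on k S n" "\<And>x. x \<in> S \<Longrightarrow> n x \<noteq> 0"
  shows "Ck_on k S (\<lambda>x. inverse (n x))"
  using assms(2)
proof (induction k)
  case 0
  then show ?case using assms(3) by (auto intro: continuous_on_inverse)
next
  case (Suc k)
  have inv: "Ck_on k S (\<lambda>x. inverse (n x))"
    using Suc Ck_on_lower by blast
  show ?case
  proof (rule Ck_on_SucI[OF assms(1)])
    show "((\<lambda>x. inverse (n x)) has_derivative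
        (\<lambda>v. - (inverse (n x) * frechet_derivative n (at x) v * inverse (n x)))) (at x)"
      if "x \<in> S" for x
      using that Suc.prems assms(3) by (intro Deriv.has_derivative_inverse Ck_on_SucD)
    show "Ck_on k S (\<lambda>x. - (inverse (n x) * frechet_derivative n (at x) v * inverse (n x)))" for v
      using Suc.prems inv
      by (intro Ck_on_linear[OF assms(1) bounded_linear_minus[OF bounded_linear_ident]]
          Ck_on_bilinear[OF assms(1) bounded_bilinear_mult]) auto
  qed
qed

text \<open>In a basis, the derivative of \<open>f (w x)\<close> in the direction \<open>v\<close> is the sum over basis vectors \<open>e\<close> of
the \<open>e\<close>-component of the derivative of \<open>w\<close> times the \<open>e\<close>-partial derivative of \<open>f\<close> at \<open>w x\<close>.  Each
partial derivative is again composed with \<open>w\<close>, which is why the induction generalises over \<open>f\<close>.\<close>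

lemma Ck_on_compose:
  fixes f :: "'b::euclidean_space \<Rightarrow> 'c::euclidean_space" and w :: "'a::euclidean_space \<Rightarrow> 'b"
  assumes "open S" "Ck_on k S w" "w ` S \<subseteq> T" "Ck_on k T f"
  shows "Ck_on k S (\<lambda>x. f (w x))"
  using assms(2,4)
proof (induction k arbitrary: f)
  case 0
  then show ?case using assms(3) continuous_on_compose2 by auto
next
  case (Suc k)
  define D where "D x v = (\<Sum>e\<in>Basis. (frechet_derivative w (at x) v \<bullet> e) *\<^sub>R
      frechet_derivative f (at (w x)) e)" for x v
  show ?case
  proof (rule Ck_on_SucI[OF assms(1)])
    show "((\<lambda>x. f (w x)) has_derivative D x) (at x)" if "x \<in> S" for x
    proof -
      have f: "(f has_derivative frechet_derivative f (at (w x))) (at (w x))"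
        using Suc.prems that assms(3) by (intro Ck_on_SucD) auto
      then interpret f: bounded_linear "frechet_derivative f (at (w x))"
        by (rule has_derivative_bounded_linear)
      have "frechet_derivative f (at (w x)) (frechet_derivative w (at x) v) = D x v" for v
        unfolding D_def
        by (subst euclidean_representation[of "frechet_derivative w (at x) v", symmetric])
          (simp add: f.sum f.scaleR del: euclidean_representation)
      then show ?thesis
        using has_derivative_compose[OF Ck_on_SucD[OF Suc.prems(1) that] f] by (simp add: fun_eq_iff)
    qed
    show "Ck_on k S (\<lambda>x. D x v)" for v
      unfolding D_def
      using Suc.prems Suc.IH[OF Ck_on_lower[OF Suc.prems(1)], of "\<lambda>y. frechet_derivative f (at y) e" for e]
      by (intro Ck_on_sum Ck_on_bilinear[OF _ bounded_bilinear_scaleR]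
          Ck_on_linear[OF _ bounded_linear_inner_left] assms(1)) auto
  qed
qed


section \<open>The moving frame of a congruence\<close>

definition stereo_factor :: "complex \<Rightarrow> real" where
  "stereo_factor \<xi> = 1 + (cmod \<xi>)\<^sup>2"

lemma stereo_factor_pos: "stereo_factor \<xi> > 0"
  unfolding stereo_factor_def by (simp add: add_pos_nonneg)

lemma stereo_factor_complex: "1 + \<xi> * cnj \<xi> = of_real (stereo_factor \<xi>)"
  unfolding stereo_factor_def of_real_add of_real_1 complex_norm_square ..

text \<open>Euclidean space as \<open>\<complex> \<times> \<real>\<close>, with coordinates \<open>z = x\<^sup>1 + \<i> x\<^sup>2\<close> and \<open>t = x\<^sup>3\<close>.\<close>

definition space_vec :: "complex \<Rightarrow> real \<Rightarrow> real^3" where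
  "space_vec z t = vector [Re z, Im z, t]"

lemma space_vec_nth [simp]:
  "space_vec z t $ 1 = Re z" "space_vec z t $ 2 = Im z" "space_vec z t $ 3 = t"
  by (simp_all add: space_vec_def)

lemma space_vec_eq_iff: "space_vec z t = space_vec z' t' \<longleftrightarrow> z = z' \<and> t = t'"
  by (auto simp: vec_eq_iff forall_3 complex_eq_iff)

lemma space_vec_cases: obtains z t where "v = space_vec z t"
  by (rule that[of "Complex (v $ 1) (v $ 2)" "v $ 3"]) (simp add: vec_eq_iff forall_3)

lemma space_vec_add: "space_vec z t + space_vec z' t' = space_vec (z + z') (t + t')"
  by (simp add: vec_eq_iff forall_3)

lemma space_vec_scaleR: "c *\<^sub>R space_vec z t = space_vec (of_real c * z) (c * t)"
  by (simp add: vec_eq_iff forall_3)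

lemma inner_space_vec: "space_vec z t \<bullet> space_vec z' t' = Re (z * cnj z') + t * t'"
  by (simp add: inner_vec_def sum_3)

lemma bounded_linear_space_vec: "bounded_linear (\<lambda>p. space_vec (fst p) (snd p))"
  by (rule linear_conv_bounded_linear[THEN iffD1], rule linearI)
    (simp_all add: vec_eq_iff forall_3)

text \<open>With \<open>n\<close> the stereographic factor, \<open>dir_num \<xi>\<close> is \<open>n\<close> times the direction \<open>W\<close> at \<open>\<xi>\<close>, and
\<open>tangent_num \<xi> \<alpha>\<close> is \<open>n\<^sup>2 / 2\<close> times the image of \<open>\<alpha> \<partial>/\<partial>\<xi>\<close> under the differential of
stereographic projection.  Clearing the denominators leaves polynomials, so that the metric facts about
the moving frame become polynomial identities.\<close>

definition dir_num :: "complex \<Rightarrow> real^3" where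
  "dir_num \<xi> = space_vec (2 * \<xi>) (2 - stereo_factor \<xi>)"

definition tangent_num :: "complex \<Rightarrow> complex \<Rightarrow> real^3" where
  "tangent_num \<xi> \<alpha> = space_vec (\<alpha> - cnj \<alpha> * \<xi>\<^sup>2) (- 2 * Re (\<alpha> * cnj \<xi>))"

lemma line_direction_eq: "line_direction \<xi> = (1 / stereo_factor \<xi>) *\<^sub>R dir_num \<xi>"
proof -
  have "1 - \<xi> * cnj \<xi> = of_real (2 - stereo_factor \<xi>)"
    using stereo_factor_complex[of \<xi>] by (simp add: algebra_simps)
  then have "line_direction \<xi> = space_vec (2 * \<xi> / of_real (stereo_factor \<xi>))
      ((2 - stereo_factor \<xi>) / stereo_factor \<xi>)"
    unfolding line_direction_def stereo_factor_complex space_vec_def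
    by (simp flip: of_real_divide del: of_real_diff)
  then show ?thesis
    by (simp add: dir_num_def space_vec_scaleR of_real_divide)
qed

lemma line_point_complex:
  "line_point \<xi> F r = space_vec (line_z \<xi> F r) (line_t \<xi> F r)"
  by (simp add: line_point_def space_vec_def)

text \<open>The foot point of the line is the tangent vector \<open>F \<partial>/\<partial>\<xi>\<close> of the sphere, seen in space.\<close>

lemma line_point_eq:
  "line_point \<xi> F r = (2 / (stereo_factor \<xi>)\<^sup>2) *\<^sub>R tangent_num \<xi> F + r *\<^sub>R line_direction \<xi>"
proof -
  let ?n = "stereo_factor \<xi>"
  have n: "?n \<noteq> 0" using stereo_factor_pos[of \<xi>] by simp
  have "1 - \<xi>\<^sup>2 * (cnj \<xi>)\<^sup>2 = (1 + \<xi> * cnj \<xi>) * (2 - (1 + \<xi> * cnj \<xi>))"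
    by (simp add: algebra_simps power2_eq_square)
  then have e1: "1 - \<xi>\<^sup>2 * (cnj \<xi>)\<^sup>2 = of_real (?n * (2 - ?n))"
    unfolding stereo_factor_complex by simp
  have e2: "F * cnj \<xi> + cnj F * \<xi> = of_real (2 * Re (F * cnj \<xi>))"
    by (simp add: complex_eq_iff)
  have "(- 2 * (F * cnj \<xi> + cnj F * \<xi>) + (1 - \<xi>\<^sup>2 * (cnj \<xi>)\<^sup>2) * of_real r) / (1 + \<xi> * cnj \<xi>)\<^sup>2
      = of_real ((- 4 * Re (F * cnj \<xi>) + ?n * (2 - ?n) * r) / ?n\<^sup>2)"
    unfolding e1 e2 stereo_factor_complex by simp
  then have t: "line_t \<xi> F r = (- 4 * Re (F * cnj \<xi>) + ?n * (2 - ?n) * r) / ?n\<^sup>2"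
    unfolding line_t_def by (simp only: Re_complex_of_real)
  have "line_z \<xi> F r = of_real (2 / ?n\<^sup>2) * (F - cnj F * \<xi>\<^sup>2) + of_real r * (of_real (1 / ?n) * (2 * \<xi>))"
    unfolding line_z_def stereo_factor_complex using n
    by (simp add: field_simps power2_eq_square)
  moreover have "line_t \<xi> F r = 2 / ?n\<^sup>2 * (- 2 * Re (F * cnj \<xi>)) + r * (1 / ?n * (2 - ?n))"
    unfolding t using n by (simp add: field_simps power2_eq_square)
  ultimately show ?thesis
    by (simp only: line_point_complex line_direction_eq dir_num_def tangent_num_def
        space_vec_scaleR space_vec_add)
qed

lemma dir_num_inner: "dir_num \<xi> \<bullet> dir_num \<xi> = (stereo_factor \<xi>)\<^sup>2"
proof -
  have "(cmod \<xi>)\<^sup>2 = (Re \<xi>)\<^sup>2 + (Im \<xi>)\<^sup>2" by (rule cmod_power2)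
  then show ?thesis
    unfolding dir_num_def inner_space_vec stereo_factor_def
    by (simp add: power2_eq_square algebra_simps)
qed

lemma dir_tangent_inner: "dir_num \<xi> \<bullet> tangent_num \<xi> \<alpha> = 0"
  unfolding dir_num_def tangent_num_def inner_space_vec stereo_factor_def cmod_power2
  by (simp add: power2_eq_square algebra_simps)

text \<open>Conformality and orientation of stereographic projection in one formula: the area form of the tangent
plane, seen from the unit normal, is a positive multiple of the area form \<open>Im (cnj \<alpha> * \<beta>)\<close> of
\<open>\<complex>\<close>.\<close>

lemma det_dir_tangent:
  "det (vector [dir_num \<xi>, tangent_num \<xi> \<alpha>, tangent_num \<xi> \<beta>] :: real^3^3)
    = (stereo_factor \<xi>)^3 * Im (cnj \<alpha> * \<beta>)"
proof (cases \<xi>, cases \<alpha>, cases \<beta>)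
  fix x y a b c d
  assume "\<xi> = Complex x y" "\<alpha> = Complex a b" "\<beta> = Complex c d"
  then show ?thesis
    unfolding dir_num_def tangent_num_def stereo_factor_def cmod_power2
    by (simp add: det_3) (simp add: power2_eq_square power3_eq_cube algebra_simps)
qed

lemma inner_line_direction: "line_direction \<xi> \<bullet> line_direction \<xi> = 1"
  using stereo_factor_pos[of \<xi>]
  by (simp add: line_direction_eq dir_num_inner power2_eq_square)

text \<open>Components along \<open>W\<close> are killed by the projection, so only the tangential parts enter, scaled by
the conformal factor \<open>4 / n\<^sup>2\<close>.\<close>

lemma perp_area_form_tangent:
  fixes \<xi> \<alpha> \<beta> :: complex and c d :: real
  defines "n \<equiv> stereo_factor \<xi>" and "W \<equiv> line_direction \<xi>"
  shows "perp_area_form W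
      (perp_proj W ((2 / n\<^sup>2) *\<^sub>R tangent_num \<xi> \<alpha> + c *\<^sub>R W))
      (perp_proj W ((2 / n\<^sup>2) *\<^sub>R tangent_num \<xi> \<beta> + d *\<^sub>R W))
    = 4 / n\<^sup>2 * Im (cnj \<alpha> * \<beta>)"
proof -
  have n: "n \<noteq> 0" using stereo_factor_pos[of \<xi>] by (simp add: n_def)
  have perp: "perp_proj W ((2 / n\<^sup>2) *\<^sub>R tangent_num \<xi> \<gamma> + e *\<^sub>R W) = (2 / n\<^sup>2) *\<^sub>R tangent_num \<xi> \<gamma>"
    for \<gamma> e
  proof -
    have "tangent_num \<xi> \<gamma> \<bullet> W = 0"
      by (simp add: W_def line_direction_eq dir_tangent_inner inner_commute)
    moreover have "W \<bullet> W = 1"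
      by (simp add: W_def inner_line_direction)
    ultimately show ?thesis
      by (simp add: perp_proj_def inner_add_left)
  qed
  have "det (vector [k *\<^sub>R u, l *\<^sub>R v, l *\<^sub>R w] :: real^3^3) = k * l * l * det (vector [u, v, w] :: real^3^3)"
    for k l :: real and u v w
    by (simp add: det_3 algebra_simps)
  then have "det (vector [W, (2 / n\<^sup>2) *\<^sub>R tangent_num \<xi> \<alpha>, (2 / n\<^sup>2) *\<^sub>R tangent_num \<xi> \<beta>] :: real^3^3)
      = 1 / n * (2 / n\<^sup>2) * (2 / n\<^sup>2) * (n^3 * Im (cnj \<alpha> * \<beta>))"
    unfolding W_def line_direction_eq by (simp add: det_dir_tangent flip: n_def)
  also have "\<dots> = 4 / n\<^sup>2 * Im (cnj \<alpha> * \<beta>)"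
    using n by (simp add: field_simps eval_nat_numeral)
  finally show ?thesis
    unfolding perp_area_form_def perp .
qed

text \<open>Differentiating the foot point \<open>F \<partial>/\<partial>\<xi>\<close> gives a tangential and a normal part.  The tangential
part is the covariant derivative on the round sphere, and the term with \<open>2 * F * cnj \<xi>\<close> is its
Christoffel term; the point at arclength \<open>r\<close> contributes \<open>r\<close> times the derivative of \<open>W\<close>.  This
is where the expressions \<open>dplus\<close> and \<open>dminus\<close> come from.\<close>

lemma line_point_has_derivative:
  fixes \<xi> F :: "complex \<Rightarrow> complex"
  assumes X: "(\<xi> has_derivative X) (at \<nu>)" and G: "(F has_derivative G) (at \<nu>)"
  defines "n \<equiv> stereo_factor (\<xi> \<nu>)"
  shows "((\<lambda>w. line_point (\<xi> w) (F w) r) has_derivative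
    (\<lambda>h. (2 / n\<^sup>2) *\<^sub>R tangent_num (\<xi> \<nu>)
            (G h + of_real r * X h - 2 * F \<nu> * cnj (\<xi> \<nu>) * X h / (1 + \<xi> \<nu> * cnj (\<xi> \<nu>)))
         + (- 4 / n\<^sup>2 * Re (F \<nu> * cnj (X h))) *\<^sub>R line_direction (\<xi> \<nu>))) (at \<nu>)"
    (is "(_ has_derivative ?D) _")
proof -
  define m where "m = 1 + \<xi> \<nu> * cnj (\<xi> \<nu>)"
  have m: "m = of_real n" by (simp add: m_def n_def stereo_factor_complex)
  have m0: "m \<noteq> 0" using stereo_factor_pos[of "\<xi> \<nu>"] by (simp add: m n_def)
  \<comment> \<open>The variables and their conjugates are kept as independent complex numbers tied by
    \<open>m = 1 + x * xb\<close>: after clearing denominators every claim is a polynomial identity.\<close>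
  define x xb f fb where abbr: "x = \<xi> \<nu>" "xb = cnj (\<xi> \<nu>)" "f = F \<nu>" "fb = cnj (F \<nu>)"
  have m_eq: "m = 1 + x * xb" by (simp add: m_def abbr)
  have Xc: "((\<lambda>w. cnj (\<xi> w)) has_derivative (\<lambda>h. cnj (X h))) (at \<nu>)"
    and Gc: "((\<lambda>w. cnj (F w)) has_derivative (\<lambda>h. cnj (G h))) (at \<nu>)"
    using X G by (auto intro: bounded_linear.has_derivative[OF bounded_linear_cnj])
  define A where "A h = G h + of_real r * X h - 2 * f * xb * X h / m" for h
  define Ab where "Ab h = cnj (G h) + of_real r * cnj (X h) - 2 * fb * x * cnj (X h) / m" for h
  have Ab: "Ab h = cnj (A h)" for h
    by (simp add: A_def Ab_def abbr m)
  define c where "c h = - 2 * (f * cnj (X h) + fb * X h) / m\<^sup>2" for h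
  have c: "of_real (- 4 / n\<^sup>2 * Re (F \<nu> * cnj (X h))) = c h" for h
  proof -
    have e: "f * cnj (X h) + fb * X h = of_real (2 * Re (F \<nu> * cnj (X h)))"
      by (simp add: complex_eq_iff abbr)
    have "complex_of_real (- 4 / n\<^sup>2 * s) = - 2 * of_real (2 * s) / (of_real n)\<^sup>2" for s :: real
      by simp
    then show ?thesis
      unfolding c_def m e by blast
  qed
  have z: "((\<lambda>w. line_z (\<xi> w) (F w) r) has_derivative
      (\<lambda>h. 2 / m\<^sup>2 * (A h - Ab h * x\<^sup>2) + c h * (2 * x / m))) (at \<nu>)"
  proof -
    have d: "((\<lambda>w. line_z (\<xi> w) (F w) r) has_derivative
      (\<lambda>h. ((2 * (G h - (cnj (G h) * x\<^sup>2 + fb * (2 * x * X h)))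
              + (2 * X h * m + 2 * x * (X h * xb + x * cnj (X h))) * of_real r) * m\<^sup>2
            - (2 * (f - fb * x\<^sup>2) + 2 * x * m * of_real r) * (2 * m * (X h * xb + x * cnj (X h))))
          / (m\<^sup>2 * m\<^sup>2))) (at \<nu>)"
      unfolding line_z_def
      using m0
      by (auto intro!: derivative_eq_intros X G Xc Gc
          simp: abbr m_def fun_eq_iff) (simp add: algebra_simps)
    have e: "((2 * (G h - (cnj (G h) * x\<^sup>2 + fb * (2 * x * X h)))
              + (2 * X h * m + 2 * x * (X h * xb + x * cnj (X h))) * of_real r) * m\<^sup>2
            - (2 * (f - fb * x\<^sup>2) + 2 * x * m * of_real r) * (2 * m * (X h * xb + x * cnj (X h))))
          / (m\<^sup>2 * m\<^sup>2) = 2 / m\<^sup>2 * (A h - Ab h * x\<^sup>2) + c h * (2 * x / m)" for h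
      using m0 unfolding A_def Ab_def c_def
      by (simp add: divide_simps) (use m_eq in algebra)
    show ?thesis using d unfolding e .
  qed
  have t: "((\<lambda>w. line_t (\<xi> w) (F w) r) has_derivative
      (\<lambda>h. Re (- 2 / m\<^sup>2 * (A h * xb + Ab h * x) + c h * ((2 - m) / m)))) (at \<nu>)"
  proof -
    have d: "((\<lambda>w. (- 2 * (F w * cnj (\<xi> w) + cnj (F w) * \<xi> w)
         + (1 - (\<xi> w)\<^sup>2 * (cnj (\<xi> w))\<^sup>2) * of_real r) / (1 + \<xi> w * cnj (\<xi> w))\<^sup>2) has_derivative
      (\<lambda>h. ((- 2 * (G h * xb + f * cnj (X h) + (cnj (G h) * x + fb * X h))
              - (2 * x * X h * xb\<^sup>2 + x\<^sup>2 * (2 * xb * cnj (X h))) * of_real r) * m\<^sup>2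
            - (- 2 * (f * xb + fb * x) + (1 - x\<^sup>2 * xb\<^sup>2) * of_real r) * (2 * m * (X h * xb + x * cnj (X h))))
          / (m\<^sup>2 * m\<^sup>2))) (at \<nu>)"
      using m0
      by (auto intro!: derivative_eq_intros X G Xc Gc
          simp: abbr m_def fun_eq_iff) (simp add: algebra_simps)
    have e: "((- 2 * (G h * xb + f * cnj (X h) + (cnj (G h) * x + fb * X h))
              - (2 * x * X h * xb\<^sup>2 + x\<^sup>2 * (2 * xb * cnj (X h))) * of_real r) * m\<^sup>2
            - (- 2 * (f * xb + fb * x) + (1 - x\<^sup>2 * xb\<^sup>2) * of_real r) * (2 * m * (X h * xb + x * cnj (X h))))
          / (m\<^sup>2 * m\<^sup>2) = - 2 / m\<^sup>2 * (A h * xb + Ab h * x) + c h * ((2 - m) / m)" for h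
      using m0 unfolding A_def Ab_def c_def
      by (simp add: divide_simps) (use m_eq in algebra)
    show ?thesis
      unfolding line_t_def
      using bounded_linear.has_derivative[OF bounded_linear_Re d] unfolding e .
  qed
  have "?D h = space_vec (2 / m\<^sup>2 * (A h - Ab h * x\<^sup>2) + c h * (2 * x / m))
      (Re (- 2 / m\<^sup>2 * (A h * xb + Ab h * x) + c h * ((2 - m) / m)))" for h
  proof -
    let ?c = "- 4 / n\<^sup>2 * Re (F \<nu> * cnj (X h))"
    have "?D h = (2 / n\<^sup>2) *\<^sub>R tangent_num x (A h) + ?c *\<^sub>R line_direction x"
      by (simp add: A_def abbr m_def)
    also have "\<dots> = space_vec (of_real (2 / n\<^sup>2) * (A h - cnj (A h) * x\<^sup>2) + of_real ?c * (of_real (1 / n) * (2 * x)))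
       (2 / n\<^sup>2 * (- 2 * Re (A h * cnj x)) + ?c * (1 / n * (2 - n)))"
      unfolding tangent_num_def line_direction_eq dir_num_def
      by (simp add: space_vec_scaleR space_vec_add abbr flip: n_def)
    also have "2 / n\<^sup>2 * (- 2 * Re (A h * cnj x)) + ?c * (1 / n * (2 - n))
       = Re (of_real (2 / n\<^sup>2 * (- 2 * Re (A h * cnj x)) + ?c * (1 / n * (2 - n))))" by simp
    also have "of_real (2 / n\<^sup>2 * (- 2 * Re (A h * cnj x)) + ?c * (1 / n * (2 - n)))
       = - 2 / m\<^sup>2 * (A h * xb + Ab h * x) + c h * ((2 - m) / m)"
    proof -
      have e: "A h * xb + Ab h * x = of_real (2 * Re (A h * cnj x))"
        by (simp add: complex_eq_iff abbr Ab)
      have "complex_of_real (2 / n\<^sup>2 * (- 2 * s) + k * (1 / n * (2 - n)))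
          = - 2 / (of_real n)\<^sup>2 * of_real (2 * s) + of_real k * ((2 - of_real n) / of_real n)"
        for s k :: real
        by simp
      then show ?thesis
        unfolding c[symmetric] m e .
    qed
    finally show ?thesis
      unfolding c by (simp add: Ab m)
  qed
  then show ?thesis
    unfolding line_point_complex
    using bounded_linear.has_derivative[OF bounded_linear_space_vec has_derivative_Pair[OF z t]]
    by simp
qed


section \<open>Curvature as a quotient of Jacobians\<close>

lemma d_nu_has_derivative:
  assumes "(f has_derivative D) (at \<nu>)"
  shows "d_nu f \<nu> = (D 1 - \<i> * D \<i>) / 2" "d_nubar f \<nu> = (D 1 + \<i> * D \<i>) / 2"
  using frechet_derivative_at[OF assms] by (simp_all add: d_nu_def d_nubar_def)

text \<open>The left-hand side is the Jacobian determinant with respect to the real coordinates.\<close>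

lemma jacobian_wirtinger:
  assumes "(f has_derivative D) (at \<nu>)"
  shows "Im (cnj (D 1) * D \<i>) = (cmod (d_nu f \<nu>))\<^sup>2 - (cmod (d_nubar f \<nu>))\<^sup>2"
  unfolding d_nu_has_derivative[OF assms] cmod_power2
  by (simp add: power2_eq_square field_simps)

text \<open>The projected displacement in the direction \<open>h\<close> is the tangent vector with complex coordinate
\<open>dplus * h + dminus * cnj h\<close>, a real-linear map whose determinant is the difference of the squared
moduli.\<close>

lemma dmu_eq:
  assumes "(\<xi> has_derivative X) (at \<nu>)" "(F has_derivative G) (at \<nu>)"
  shows "dmu \<xi> F \<nu> r 1 \<i> = 4 / (stereo_factor (\<xi> \<nu>))\<^sup>2 *
    ((cmod (dplus \<xi> F \<nu> r))\<^sup>2 - (cmod (dminus \<xi> F \<nu> r))\<^sup>2)"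
proof -
  define A where "A h = G h + of_real r * X h - 2 * F \<nu> * cnj (\<xi> \<nu>) * X h / (1 + \<xi> \<nu> * cnj (\<xi> \<nu>))"
    for h
  define k where "k = 2 * F \<nu> * cnj (\<xi> \<nu>) / (1 + \<xi> \<nu> * cnj (\<xi> \<nu>))"
  have A: "A h = G h + of_real r * X h - k * X h" for h
    by (simp add: A_def k_def)
  have dp: "dplus \<xi> F \<nu> r = d_nu F \<nu> + of_real r * d_nu \<xi> \<nu> - k * d_nu \<xi> \<nu>"
    and dm: "dminus \<xi> F \<nu> r = d_nubar F \<nu> + of_real r * d_nubar \<xi> \<nu> - k * d_nubar \<xi> \<nu>"
    by (simp_all add: dplus_def dminus_def k_def)
  have eqs: "dplus \<xi> F \<nu> r = (A 1 - \<i> * A \<i>) / 2" "dminus \<xi> F \<nu> r = (A 1 + \<i> * A \<i>) / 2"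
    unfolding dp dm d_nu_has_derivative[OF assms(1)] d_nu_has_derivative[OF assms(2)] A
    by (simp_all add: field_simps)
  have "Im (cnj (A 1) * A \<i>) = (cmod (dplus \<xi> F \<nu> r))\<^sup>2 - (cmod (dminus \<xi> F \<nu> r))\<^sup>2"
    unfolding eqs cmod_power2 by (simp add: power2_eq_square field_simps)
  then show ?thesis
    unfolding dmu_def Let_def dPhi_def
      frechet_derivative_at[OF line_point_has_derivative[OF assms], symmetric] A_def[symmetric]
      perp_area_form_tangent
    by simp
qed

text \<open>Expanding the two squared moduli, the mixed terms agree and cancel, and the numerator factors as the
Jacobian of \<open>\<xi>\<close> times the denominator.  So \<open>curvature\<close> is a quotient of Jacobians, as the
Gauss curvature is.\<close>

lemma curvature_eq:
  assumes "\<xi> differentiable (at \<nu>)" and "Delta \<xi> F \<nu> r \<noteq> 0"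
  shows "curvature \<xi> F \<nu> r = ((cmod (d_nu \<xi> \<nu>))\<^sup>2 - (cmod (d_nubar \<xi> \<nu>))\<^sup>2)
      / ((cmod (dplus \<xi> F \<nu> r))\<^sup>2 - (cmod (dminus \<xi> F \<nu> r))\<^sup>2)"
proof -
  define a b p q where abbr: "a = dplus \<xi> F \<nu> r" "b = dminus \<xi> F \<nu> r" "p = d_nu \<xi> \<nu>" "q = d_nubar \<xi> \<nu>"
  define d where "d = (cmod a)\<^sup>2 - (cmod b)\<^sup>2"
  obtain X where X: "(\<xi> has_derivative X) (at \<nu>)"
    using assms(1) by (auto simp: differentiable_def)
  have Xc: "((\<lambda>w. cnj (\<xi> w)) has_derivative (\<lambda>h. cnj (X h))) (at \<nu>)"
    using X by (rule bounded_linear.has_derivative[OF bounded_linear_cnj])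
  have conj: "d_nubar (\<lambda>w. cnj (\<xi> w)) \<nu> = cnj p" "d_nu (\<lambda>w. cnj (\<xi> w)) \<nu> = cnj q"
    unfolding abbr d_nu_has_derivative[OF X] d_nu_has_derivative[OF Xc] by simp_all
  have den: "b * cnj b - a * cnj a = - of_real d"
    unfolding d_def of_real_diff complex_norm_square by simp
  have "d \<noteq> 0"
  proof
    assume "d = 0"
    then have "a * cnj a - b * cnj b = 0" using den by (simp add: algebra_simps)
    then show False using assms(2) unfolding Delta_def by (simp add: abbr)
  qed
  have num: "(a * cnj p - b * cnj q) * cnj (a * cnj p - b * cnj q)
      - (cnj a * cnj q - cnj b * cnj p) * cnj (cnj a * cnj q - cnj b * cnj p)
      = of_real (d * ((cmod p)\<^sup>2 - (cmod q)\<^sup>2))"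
    unfolding d_def of_real_mult of_real_diff complex_norm_square by (simp add: algebra_simps)
  have "rho \<xi> F \<nu> r = (a * cnj p - b * cnj q) / (- of_real d)"
    and "sigma \<xi> F \<nu> r = (cnj a * cnj q - cnj b * cnj p) / (- of_real d)"
    unfolding rho_def sigma_def conj abbr[symmetric] den by simp_all
  moreover have "(P / - of_real d) * cnj (P / - of_real d) - (Q / - of_real d) * cnj (Q / - of_real d)
      = (P * cnj P - Q * cnj Q) / (of_real d)\<^sup>2" for P Q
    by (simp add: diff_divide_distrib power2_eq_square)
  ultimately have "rho \<xi> F \<nu> r * cnj (rho \<xi> F \<nu> r) - sigma \<xi> F \<nu> r * cnj (sigma \<xi> F \<nu> r)
     = ((a * cnj p - b * cnj q) * cnj (a * cnj p - b * cnj q)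
      - (cnj a * cnj q - cnj b * cnj p) * cnj (cnj a * cnj q - cnj b * cnj p)) / (of_real d)\<^sup>2"
    by (simp only:)
  also have "\<dots> = of_real (((cmod p)\<^sup>2 - (cmod q)\<^sup>2) / d)"
    unfolding num using \<open>d \<noteq> 0\<close> by (simp add: field_simps power2_eq_square)
  finally show ?thesis
    unfolding curvature_def by (simp add: abbr d_def)
qed

text \<open>The heart of the matter: the determinant of the projected displacement cancels, and with it every trace
of \<open>F\<close> and \<open>r\<close>.  What is left is the pull-back of the area form of the unit sphere.\<close>

lemma curvature_times_dmu:
  assumes "\<xi> differentiable (at \<nu>)" "F differentiable (at \<nu>)" and "Delta \<xi> F \<nu> r \<noteq> 0"
  shows "curvature \<xi> F \<nu> r * dmu \<xi> F \<nu> r 1 \<i>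
    = ((cmod (d_nu \<xi> \<nu>))\<^sup>2 - (cmod (d_nubar \<xi> \<nu>))\<^sup>2) * (4 / (stereo_factor (\<xi> \<nu>))\<^sup>2)"
proof -
  obtain X G where XG: "(\<xi> has_derivative X) (at \<nu>)" "(F has_derivative G) (at \<nu>)"
    using assms(1,2) by (auto simp: differentiable_def)
  have "(cmod (dplus \<xi> F \<nu> r))\<^sup>2 - (cmod (dminus \<xi> F \<nu> r))\<^sup>2 \<noteq> 0"
  proof
    assume "(cmod (dplus \<xi> F \<nu> r))\<^sup>2 - (cmod (dminus \<xi> F \<nu> r))\<^sup>2 = 0"
    then have "complex_of_real ((cmod (dplus \<xi> F \<nu> r))\<^sup>2 - (cmod (dminus \<xi> F \<nu> r))\<^sup>2) = 0"
      by (simp only: of_real_0)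
    then show False
      using assms(3) unfolding Delta_def of_real_diff complex_norm_square by simp
  qed
  moreover have "j / d * (k * d) = j * k" if "d \<noteq> 0" for j d k :: real
    using that by simp
  ultimately show ?thesis
    unfolding curvature_eq[OF assms(1,3)] dmu_eq[OF XG] by blast
qed


section \<open>Global convexity and the stereographic parameter\<close>

lemma line_direction_eq_space_vec:
  "line_direction \<xi> = space_vec (2 * \<xi> / of_real (stereo_factor \<xi>)) (2 / stereo_factor \<xi> - 1)"
  using stereo_factor_pos[of \<xi>]
  by (simp add: line_direction_eq dir_num_def space_vec_scaleR field_simps)

lemma norm_line_direction: "norm (line_direction \<xi>) = 1"
  by (simp add: norm_eq_sqrt_inner inner_line_direction)

lemma inj_line_direction: "inj line_direction"
proof
  fix \<xi> \<zeta> assume "line_direction \<xi> = line_direction \<zeta>"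
  then have *: "2 * \<xi> / of_real (stereo_factor \<xi>) = 2 * \<zeta> / of_real (stereo_factor \<zeta>)"
    "2 / stereo_factor \<xi> - 1 = 2 / stereo_factor \<zeta> - 1"
    unfolding line_direction_eq_space_vec space_vec_eq_iff by blast+
  then have eq: "stereo_factor \<xi> = stereo_factor \<zeta>" by simp
  have "complex_of_real (stereo_factor \<zeta>) \<noteq> 0"
    using stereo_factor_pos[of \<zeta>] by simp
  then show "\<xi> = \<zeta>"
    using *(1) unfolding eq by (metis divide_cancel_right mult_cancel_left zero_neq_numeral)
qed

lemma line_direction_neq_south_pole: "line_direction \<xi> \<noteq> south_pole"
proof
  assume "line_direction \<xi> = south_pole"
  then have "line_direction \<xi> $ 3 = - 1" by (simp add: south_pole_def)
  then show False
    using stereo_factor_pos[of \<xi>] by (simp add: line_direction_eq_space_vec)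
qed

text \<open>The preimage is stereographic projection from the South pole, \<open>z / (1 + t)\<close>.\<close>

lemma line_direction_surj:
  assumes "norm W = 1" "W \<noteq> south_pole"
  obtains \<xi> where "line_direction \<xi> = W"
proof -
  obtain z t where W: "W = space_vec z t" by (rule space_vec_cases)
  have "W \<bullet> W = 1" using assms(1) by (simp add: norm_eq_1)
  then have zt: "(cmod z)\<^sup>2 = (1 - t) * (1 + t)"
    unfolding W inner_space_vec cmod_power2 by (simp add: power2_eq_square algebra_simps)
  have t: "1 + t \<noteq> 0"
  proof
    assume "1 + t = 0"
    then have "z = 0" "t = -1" using zt by auto
    then have "W = south_pole" by (simp add: W space_vec_def south_pole_def)
    then show False using assms(2) by contradiction
  qed
  have "(1 - t) * (1 + t) / (1 + t)\<^sup>2 = (1 - t) / (1 + t)"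
    by (simp add: power2_eq_square)
  moreover have "1 + (1 - t) / (1 + t) = 2 / (1 + t)"
    using t by (simp add: field_simps)
  ultimately have "stereo_factor (z / of_real (1 + t)) = 2 / (1 + t)"
    unfolding stereo_factor_def norm_divide power_divide zt norm_of_real power2_abs by simp
  moreover have "1 + complex_of_real t \<noteq> 0"
    using t by (metis of_real_1 of_real_add of_real_eq_0_iff)
  ultimately have "line_direction (z / of_real (1 + t)) = W"
    unfolding line_direction_eq_space_vec W using t by (simp add: space_vec_eq_iff add_divide_distrib)
  then show thesis by (rule that)
qed

text \<open>The fibre coordinate \<open>F\<close> of the line in direction \<open>\<xi>\<close> whose foot point is \<open>U\<close>.  For
\<open>U = (z, t)\<close> it is \<open>(z - 2 t \<xi> - cnj z \<xi>\<^sup>2) / 2\<close>, the components of \<open>U\<close> along the conformal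
frame of the tangent plane.\<close>

definition foot_coord :: "real^3 \<Rightarrow> complex \<Rightarrow> complex" where
  "foot_coord U \<xi> = (Complex (U $ 1) (U $ 2) - 2 * of_real (U $ 3) * \<xi>
      - Complex (U $ 1) (- (U $ 2)) * \<xi>\<^sup>2) / 2"

lemma line_point_foot_coord:
  assumes "U \<bullet> line_direction \<xi> = 0"
  shows "line_point \<xi> (foot_coord U \<xi>) 0 = U"
proof -
  obtain z t where U: "U = space_vec z t" by (rule space_vec_cases)
  let ?n = "stereo_factor \<xi>"
  have n: "?n \<noteq> 0" using stereo_factor_pos[of \<xi>] by simp
  have "U \<bullet> dir_num \<xi> = 0"
    using assms n by (simp add: line_direction_eq)
  then have "2 * Re (z * cnj \<xi>) + t * (2 - ?n) = 0"
    unfolding U dir_num_def inner_space_vec by (simp add: algebra_simps)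
  then have orth: "2 * (Re z * Re \<xi> + Im z * Im \<xi>) + t * (1 - (Re \<xi>)\<^sup>2 - (Im \<xi>)\<^sup>2) = 0"
    unfolding stereo_factor_def cmod_power2 by (simp add: algebra_simps)
  have "2 *\<^sub>R tangent_num \<xi> (foot_coord U \<xi>) = ?n\<^sup>2 *\<^sub>R U"
  proof (cases \<xi>, cases z)
    fix x y a b assume eqs: "\<xi> = Complex x y" "z = Complex a b"
    show ?thesis
      using orth
      unfolding eqs U tangent_num_def foot_coord_def stereo_factor_def cmod_power2 space_vec_scaleR space_vec_eq_iff
        complex_eq_iff
      by (simp add: power2_eq_square) (intro conjI; algebra)
  qed
  then have "(2 / ?n\<^sup>2) *\<^sub>R tangent_num \<xi> (foot_coord U \<xi>) = U"
    using n by (metis (no_types, lifting) divide_inverse_commute scaleR_scaleR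
        power_not_zero left_inverse scaleR_one)
  then show ?thesis
    by (simp add: line_point_eq)
qed

lemma Ck_on_line_direction:
  assumes "open S"
  shows "Ck_on k S line_direction"
proof -
  have eq: "line_direction = (\<lambda>\<xi>. inverse (1 + \<xi> \<bullet> \<xi>) *\<^sub>R (space_vec (2 * \<xi>) 0 + (1 + - (\<xi> \<bullet> \<xi>)) *\<^sub>R space_vec 0 1))"
    by (simp add: fun_eq_iff line_direction_eq dir_num_def stereo_factor_def power2_norm_eq_inner
        space_vec_scaleR space_vec_add divide_inverse)
  have lin: "bounded_linear (\<lambda>\<xi>. space_vec (2 * \<xi>) 0)"
    using bounded_linear_compose[OF bounded_linear_space_vec
        bounded_linear_Pair[OF bounded_linear_mult_right[of 2] bounded_linear_zero]] by simp
  have sq: "Ck_on k S (\<lambda>\<xi>::complex. \<xi> \<bullet> \<xi>)"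
    by (intro Ck_on_bilinear[OF assms bounded_bilinear_inner] Ck_on_ident assms)
  have "1 + \<xi> \<bullet> \<xi> \<noteq> 0" for \<xi> :: complex
    using inner_ge_zero[of \<xi>] by linarith
  then show ?thesis
    unfolding eq
    by (intro Ck_on_bilinear[OF assms bounded_bilinear_scaleR] Ck_on_inverse Ck_on_add Ck_on_const sq assms
        Ck_on_linear[OF assms lin] Ck_on_ident Ck_on_linear[OF assms bounded_linear_minus[OF bounded_linear_ident]])
qed

text \<open>Near each point the section is the restriction of a smooth map on an open set of space, and the
direction map takes values in the sphere, where the two agree.\<close>

lemma smooth_on_sphere_pullback:
  assumes "smooth_map_on (sphere 0 1) s"
  shows "smooth_on UNIV (\<lambda>\<xi>. s (line_direction \<xi>))"
  unfolding smooth_on_def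
proof (intro allI Ck_on_locally)
  fix k \<xi>
  have sph: "line_direction \<zeta> \<in> sphere 0 1" for \<zeta>
    by (simp add: norm_line_direction)
  obtain N g where N: "open N" "line_direction \<xi> \<in> N" and g: "smooth_on N g"
    and gs: "\<forall>y\<in>N \<inter> sphere 0 1. g y = s y"
    using assms sph unfolding smooth_map_on_def by blast
  have cont: "continuous_on UNIV line_direction"
    using Ck_on_line_direction[of UNIV 0] by simp
  have M: "open (line_direction -` N)"
    using N(1) cont by (rule open_vimage)
  have "Ck_on k (line_direction -` N) (\<lambda>\<xi>. g (line_direction \<xi>))"
    using g unfolding smooth_on_def
    by (intro Ck_on_compose[OF M Ck_on_line_direction[OF M]]) auto
  then have "Ck_on k (line_direction -` N) (\<lambda>\<xi>. s (line_direction \<xi>))"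
    by (rule Ck_on_cong[OF M, rotated]) (use gs sph in auto)
  then show "\<exists>M. open M \<and> \<xi> \<in> M \<and> Ck_on k M (\<lambda>\<xi>. s (line_direction \<xi>))"
    using M N(2) by blast
qed

lemma smooth_on_foot_coord:
  assumes S: "open S" and U: "smooth_on S U"
  shows "smooth_on S (\<lambda>\<xi>. foot_coord (U \<xi>) \<xi>)"
  unfolding smooth_on_def
proof
  fix k
  let ?P = "\<lambda>v :: real^3. Complex (v $ 1) (v $ 2)"
  let ?T = "\<lambda>v :: real^3. complex_of_real (- 2 * v $ 3)"
  let ?C = "\<lambda>v :: real^3. Complex (- (v $ 1)) (v $ 2)"
  have lin: "bounded_linear ?P" "bounded_linear ?T" "bounded_linear ?C"
    by (auto simp: linear_conv_bounded_linear[symmetric] complex_eq_iff algebra_simps intro!: linearI)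
  have half: "bounded_linear (\<lambda>z :: complex. z / 2)"
    by (rule bounded_linear_divide)
  have eq: "foot_coord v \<xi> = (?P v + ?T v * \<xi> + ?C v * (\<xi> * \<xi>)) / 2" for v \<xi>
  proof -
    have "?C v = - Complex (v $ 1) (- (v $ 2))" by (simp add: complex_eq_iff)
    then show ?thesis by (simp add: foot_coord_def power2_eq_square)
  qed
  have "Ck_on k S U" using U by (simp add: smooth_on_def)
  then show "Ck_on k S (\<lambda>\<xi>. foot_coord (U \<xi>) \<xi>)"
    unfolding eq
    by (intro Ck_on_linear[OF S half] Ck_on_add Ck_on_bilinear[OF S bounded_bilinear_mult]
        Ck_on_linear[OF S lin(1)] Ck_on_linear[OF S lin(2)] Ck_on_linear[OF S lin(3)] Ck_on_ident S)
qed

text \<open>A graph over the sphere is parametrised by its direction alone.  One stereographic chart suffices for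
all lines but the one in the South pole direction.\<close>

lemma global_stereographic_param:
  assumes s: "smooth_map_on (sphere 0 1) s" "\<And>W. W \<in> sphere 0 1 \<Longrightarrow> (s W, W) \<in> oriented_lines"
    and \<Sigma>: "\<Sigma> = (\<lambda>W. (s W, W)) ` sphere 0 1"
  defines "F \<equiv> \<lambda>\<xi>. foot_coord (s (line_direction \<xi>)) \<xi>"
  shows "line_of \<xi> (F \<xi>) = (s (line_direction \<xi>), line_direction \<xi>)"
    and "oriented_param \<Sigma> UNIV (\<lambda>\<nu>. \<nu>) F"
proof -
  have sph: "line_direction \<zeta> \<in> sphere 0 1" for \<zeta>
    by (simp add: norm_line_direction)
  have line: "line_of \<xi> (F \<xi>) = (s (line_direction \<xi>), line_direction \<xi>)" for \<xi>
    using s(2)[OF sph[of \<xi>]] by (simp add: line_of_def F_def oriented_lines_def line_point_foot_coord)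
  then show "line_of \<xi> (F \<xi>) = (s (line_direction \<xi>), line_direction \<xi>)" .
  have "smooth_on UNIV (\<lambda>\<nu> :: complex. \<nu>)"
    by (simp add: smooth_on_def Ck_on_ident)
  moreover have "smooth_on UNIV F"
    unfolding F_def by (intro smooth_on_foot_coord smooth_on_sphere_pullback s open_UNIV)
  moreover have "inj (\<lambda>\<nu>. line_of \<nu> (F \<nu>))"
    using inj_line_direction by (auto simp: line inj_def)
  moreover have "d_nu (\<lambda>\<nu>. \<nu>) \<nu> = 1" "d_nubar (\<lambda>\<nu>. \<nu>) \<nu> = 0" for \<nu>
    by (simp_all add: d_nu_has_derivative[OF has_derivative_ident])
  ultimately show "oriented_param \<Sigma> UNIV (\<lambda>\<nu>. \<nu>) F"
    unfolding oriented_param_def using sph by (auto simp: line \<Sigma>)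
qed


section \<open>Change of variables in the complex plane\<close>

text \<open>The integral over a box is invariant by the substitution rule for boxes.  Preservation of the norm
carries the exhausting balls of one space to those of the other, which extends the invariance to all
sets.\<close>

lemma has_integral_isometry:
  fixes g :: "'a::euclidean_space \<Rightarrow> 'b::euclidean_space" and f :: "'b \<Rightarrow> 'c::banach"
  assumes hg: "\<And>x. h (g x) = x" and gh: "\<And>y. g (h y) = y"
    and cont: "\<And>x. continuous (at x) g" and norm: "\<And>x. norm (g x) = norm x"
    and gbox: "\<And>a b. \<exists>c d. g ` cbox a b = cbox c d"
    and hbox: "\<And>c d. \<exists>a b. h ` cbox c d = cbox a b"
    and content: "\<And>a b. measure lborel (g ` cbox a b) = measure lborel (cbox a b)"
    and f: "(f has_integral i) S"
  shows "((\<lambda>x. f (g x)) has_integral i) (g -` S)"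
proof (rule has_integral'[THEN iffD2], intro allI impI)
  fix e :: real
  assume "0 < e"
  then obtain B where "0 < B" and B: "\<And>c d. ball 0 B \<subseteq> cbox c d \<Longrightarrow>
      \<exists>z. ((\<lambda>y. if y \<in> S then f y else 0) has_integral z) (cbox c d) \<and> norm (z - i) < e"
    using has_integral'[THEN iffD1, OF f] by blast
  show "\<exists>B>0. \<forall>a b. ball 0 B \<subseteq> cbox a b \<longrightarrow>
      (\<exists>z. ((\<lambda>x. if x \<in> g -` S then f (g x) else 0) has_integral z) (cbox a b) \<and> norm (z - i) < e)"
  proof (intro exI[of _ B] conjI allI impI)
    fix a b :: 'a
    assume ab: "ball 0 B \<subseteq> cbox a b"
    obtain c d where cd: "g ` cbox a b = cbox c d"
      using gbox by blast
    have "ball 0 B \<subseteq> cbox c d"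
    proof
      fix y :: 'b
      assume "y \<in> ball 0 B"
      then have "h y \<in> cbox a b"
        using ab norm[of "h y"] gh by auto
      then show "y \<in> cbox c d"
        using gh[of y] cd by force
    qed
    then obtain z where
      z: "((\<lambda>y. if y \<in> S then f y else 0) has_integral z) (cbox c d)" "norm (z - i) < e"
      using B by blast
    have "h ` cbox c d = cbox a b"
      unfolding cd[symmetric] by (simp add: image_image hg)
    then have "((\<lambda>x. if g x \<in> S then f (g x) else 0) has_integral z) (cbox a b)"
      using has_integral_twiddle[of 1 h g, OF _ hg gh cont gbox hbox _ z(1)] content by simp
    then show "\<exists>z. ((\<lambda>x. if x \<in> g -` S then f (g x) else 0) has_integral z) (cbox a b)
        \<and> norm (z - i) < e"
      using z(2) by auto
  qed (rule \<open>0 < B\<close>)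
qed

text \<open>The substitution rule for multiple integrals concerns the spaces \<open>real ^ 'n\<close>, whereas the parameters
of a congruence are complex numbers; this identification transports the rule.\<close>

definition complex_of_vec :: "real^2 \<Rightarrow> complex" where
  "complex_of_vec x = Complex (x $ 1) (x $ 2)"

definition vec_of_complex :: "complex \<Rightarrow> real^2" where
  "vec_of_complex z = vector [Re z, Im z]"

lemma complex_of_vec_inverse [simp]: "vec_of_complex (complex_of_vec x) = x"
  by (simp add: complex_of_vec_def vec_of_complex_def vec_eq_iff forall_2)

lemma vec_of_complex_inverse [simp]: "complex_of_vec (vec_of_complex z) = z"
  by (simp add: complex_of_vec_def vec_of_complex_def)

lemma norm_complex_of_vec: "norm (complex_of_vec x) = norm x"
  by (simp add: complex_of_vec_def norm_vec_def L2_set_def sum_2 cmod_def)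

lemma norm_vec_of_complex: "norm (vec_of_complex z) = norm z"
  using norm_complex_of_vec[of "vec_of_complex z"] by simp

lemma bounded_linear_complex_of_vec: "bounded_linear complex_of_vec"
  by (rule bounded_linear_intro[where K = 1])
    (simp_all add: norm_complex_of_vec, simp_all add: complex_of_vec_def complex_eq_iff)

lemma bounded_linear_vec_of_complex: "bounded_linear vec_of_complex"
  by (rule bounded_linear_intro[where K = 1])
    (simp_all add: norm_vec_of_complex, simp_all add: vec_of_complex_def vec_eq_iff forall_2)

lemma complex_of_vec_mem_cbox:
  "complex_of_vec x \<in> cbox (complex_of_vec a) (complex_of_vec b) \<longleftrightarrow> x \<in> cbox a b"
  unfolding mem_box_cart by (auto simp: mem_box Basis_complex_def forall_2 complex_of_vec_def)

lemma complex_of_vec_cbox: "complex_of_vec ` cbox a b = cbox (complex_of_vec a) (complex_of_vec b)"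
proof (intro equalityI subsetI)
  fix z assume "z \<in> cbox (complex_of_vec a) (complex_of_vec b)"
  then have "vec_of_complex z \<in> cbox a b"
    using complex_of_vec_mem_cbox[of "vec_of_complex z"] by simp
  then show "z \<in> complex_of_vec ` cbox a b"
    by (metis image_eqI vec_of_complex_inverse)
qed (auto simp: complex_of_vec_mem_cbox)

lemma vec_of_complex_cbox: "vec_of_complex ` cbox c d = cbox (vec_of_complex c) (vec_of_complex d)"
proof -
  have "cbox c d = complex_of_vec ` cbox (vec_of_complex c) (vec_of_complex d)"
    by (simp add: complex_of_vec_cbox)
  then show ?thesis by (simp add: image_image)
qed

lemma content_complex_of_vec_cbox: "measure lborel (complex_of_vec ` cbox a b) = measure lborel (cbox a b)"
proof -
  have "cbox (complex_of_vec a) (complex_of_vec b) = {} \<longleftrightarrow> cbox a b = {}"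
    by (simp flip: complex_of_vec_cbox)
  moreover have "(\<Prod>i\<in>Basis. complex_of_vec b \<bullet> i - complex_of_vec a \<bullet> i) = (\<Prod>i\<in>UNIV. b $ i - a $ i)"
    by (simp add: Basis_complex_def complex_of_vec_def prod_2 UNIV_2)
  ultimately show ?thesis
    using content_cbox_if[of "complex_of_vec a" "complex_of_vec b"] content_cbox_if_cart[of a b]
    by (simp add: complex_of_vec_cbox)
qed

lemma vimage_complex_of_vec: "complex_of_vec -` S = vec_of_complex ` S"
proof (intro equalityI subsetI)
  show "x \<in> vec_of_complex ` S" if "x \<in> complex_of_vec -` S" for x
    using that by (intro image_eqI[of _ _ "complex_of_vec x"]) auto
qed auto

lemma has_integral_complex_of_vec_iff:
  fixes f :: "complex \<Rightarrow> 'c::banach"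
  shows "((\<lambda>x. f (complex_of_vec x)) has_integral i) (complex_of_vec -` S) \<longleftrightarrow> (f has_integral i) S"
proof
  assume "(f has_integral i) S"
  then show "((\<lambda>x. f (complex_of_vec x)) has_integral i) (complex_of_vec -` S)"
    by (intro has_integral_isometry[where h = vec_of_complex])
      (auto simp: norm_complex_of_vec complex_of_vec_cbox vec_of_complex_cbox
        content_complex_of_vec_cbox[unfolded complex_of_vec_cbox]
        intro!: linear_continuous_at bounded_linear_complex_of_vec)
next
  assume *: "((\<lambda>x. f (complex_of_vec x)) has_integral i) (complex_of_vec -` S)"
  have "measure lborel (vec_of_complex ` cbox c d) = measure lborel (cbox c d)" for c d
    using content_complex_of_vec_cbox[of "vec_of_complex c" "vec_of_complex d"]
    by (simp add: complex_of_vec_cbox vec_of_complex_cbox)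
  then have "((\<lambda>z. f (complex_of_vec (vec_of_complex z))) has_integral i)
      (vec_of_complex -` (complex_of_vec -` S))"
    by (intro has_integral_isometry[OF _ _ _ _ _ _ _ *, where h = complex_of_vec])
      (auto simp: norm_vec_of_complex complex_of_vec_cbox vec_of_complex_cbox
        intro!: linear_continuous_at bounded_linear_vec_of_complex)
  then show "(f has_integral i) S"
    by (simp add: vimage_def)
qed

lemma absolutely_integrable_complex_of_vec_iff:
  fixes f :: "complex \<Rightarrow> real"
  shows "(\<lambda>x. f (complex_of_vec x)) absolutely_integrable_on (complex_of_vec -` S)
    \<longleftrightarrow> f absolutely_integrable_on S"
  using has_integral_complex_of_vec_iff[of f _ S] has_integral_complex_of_vec_iff[of "\<lambda>x. norm (f x)" _ S]
  by (simp add: absolutely_integrable_on_def integrable_on_def)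

lemma integral_complex_of_vec:
  fixes f :: "complex \<Rightarrow> real"
  shows "integral (complex_of_vec -` S) (\<lambda>x. f (complex_of_vec x)) = integral S f"
  using has_integral_complex_of_vec_iff[of f _ S]
  by (cases "f integrable_on S")
    (auto simp: integrable_on_def not_integrable_integral integral_unique)

text \<open>\<open>Im (cnj a * b)\<close> is the determinant of the real matrix with columns \<open>a\<close> and \<open>b\<close>.\<close>

lemma complex_change_of_variables:
  fixes f :: "complex \<Rightarrow> real"
  assumes S: "S \<in> sets lebesgue"
    and der: "\<And>z. z \<in> S \<Longrightarrow> (g has_derivative g' z) (at z within S)"
    and inj: "inj_on g S"
    and f: "f absolutely_integrable_on (g ` S)"
  shows "(\<lambda>z. \<bar>Im (cnj (g' z 1) * g' z \<i>)\<bar> * f (g z)) absolutely_integrable_on S"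
    and "integral S (\<lambda>z. \<bar>Im (cnj (g' z 1) * g' z \<i>)\<bar> * f (g z)) = integral (g ` S) f"
proof -
  define T where "T = complex_of_vec -` S"
  define G where "G x = vec_of_complex (g (complex_of_vec x))" for x
  define G' where "G' x h = vec_of_complex (g' (complex_of_vec x) (complex_of_vec h))" for x h
  define J where "J z = \<bar>Im (cnj (g' z 1) * g' z \<i>)\<bar>" for z
  have T_image: "T = vec_of_complex ` S"
    unfolding T_def by (rule vimage_complex_of_vec)
  have T: "T \<in> sets lebesgue"
    unfolding T_image
    by (rule differentiable_image_in_sets_lebesgue[OF S])
      (auto simp: bounded_linear_imp_differentiable_on bounded_linear_vec_of_complex)
  have GT: "G ` T = complex_of_vec -` (g ` S)"
    unfolding vimage_complex_of_vec by (simp add: G_def T_image image_image)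
  have injT: "inj_on G T"
    unfolding G_def T_def inj_on_def
    by (metis complex_of_vec_inverse vec_of_complex_inverse inj inj_onD vimageE)
  have derT: "(G has_derivative G' x) (at x within T)" if "x \<in> T" for x
  proof -
    have c: "(complex_of_vec has_derivative complex_of_vec) (at x within T)"
      by (rule bounded_linear_imp_has_derivative[OF bounded_linear_complex_of_vec])
    have "complex_of_vec ` T \<subseteq> S"
      by (auto simp: T_def)
    then have "((\<lambda>x. g (complex_of_vec x)) has_derivative
        (\<lambda>h. g' (complex_of_vec x) (complex_of_vec h))) (at x within T)"
      using that by (intro has_derivative_in_compose2[OF der _ _ c]) (auto simp: T_def)
    then show ?thesis
      unfolding G_def G'_def
      by (rule bounded_linear.has_derivative[OF bounded_linear_vec_of_complex])
  qed
  have det: "\<bar>det (matrix (G' x))\<bar> = J (complex_of_vec x)" for x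
  proof -
    have "complex_of_vec (axis 1 1) = 1" "complex_of_vec (axis 2 1) = \<i>"
      by (simp_all add: complex_of_vec_def axis_def complex_eq_iff)
    then show ?thesis
      by (simp add: det_2 matrix_def G'_def J_def vec_of_complex_def mult.commute)
  qed
  let ?f = "\<lambda>x. vec (f (complex_of_vec x)) :: real^1"
  have "?f absolutely_integrable_on (G ` T)"
    using f by (simp add: absolutely_integrable_on_1_iff GT absolutely_integrable_complex_of_vec_iff)
  then have "(\<lambda>x. \<bar>det (matrix (G' x))\<bar> *\<^sub>R ?f (G x)) absolutely_integrable_on T \<and>
      integral T (\<lambda>x. \<bar>det (matrix (G' x))\<bar> *\<^sub>R ?f (G x)) = integral (G ` T) ?f"
    using has_absolute_integral_change_of_variables[OF T derT injT,
        where f = ?f and b = "integral (G ` T) ?f"] by simp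
  then have "(\<lambda>x. J (complex_of_vec x) * f (g (complex_of_vec x))) absolutely_integrable_on T \<and>
      integral T (\<lambda>x. J (complex_of_vec x) * f (g (complex_of_vec x)))
        = integral (G ` T) (\<lambda>x. f (complex_of_vec x))"
    by (simp add: absolutely_integrable_on_1_iff integral_on_1_eq det G_def vec_eq_iff)
  then show "(\<lambda>z. \<bar>Im (cnj (g' z 1) * g' z \<i>)\<bar> * f (g z)) absolutely_integrable_on S"
    and "integral S (\<lambda>z. \<bar>Im (cnj (g' z 1) * g' z \<i>)\<bar> * f (g z)) = integral (g ` S) f"
    using absolutely_integrable_complex_of_vec_iff[where f = "\<lambda>z. J z * f (g z)" and S = S]
      integral_complex_of_vec[where f = "\<lambda>z. J z * f (g z)" and S = S]
      integral_complex_of_vec[where f = f and S = "g ` S"]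
    unfolding J_def[symmetric] T_def[symmetric] by (simp_all add: GT)
qed

text \<open>Finite additivity, followed by dominated convergence along the partial unions.\<close>

lemma integral_sums_disjoint:
  fixes f :: "'a::euclidean_space \<Rightarrow> real"
  assumes meas: "\<And>i. B i \<in> sets lebesgue" and disj: "disjoint_family B"
    and f: "f absolutely_integrable_on (\<Union>i. B i)"
  shows "(\<lambda>i. integral (B i) f) sums integral (\<Union>i. B i) f"
proof -
  have int: "f absolutely_integrable_on C" if "C \<subseteq> (\<Union>i. B i)" "C \<in> sets lebesgue" for C
    using set_integrable_subset[OF f that(2,1)] .
  have eq: "(LINT x:C|lebesgue. f x) = integral C f" if "C \<subseteq> (\<Union>i. B i)" "C \<in> sets lebesgue" for C
    by (rule set_lebesgue_integral_eq_integral(2)[OF int[OF that]])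
  have UN: "(\<Union>n. \<Union>i<n. B i) = (\<Union>i. B i)"
    by (auto intro: lessI)
  have "(\<Sum>i<n. integral (B i) f) = (LINT x:(\<Union>i<n. B i)|lebesgue. f x)" for n
  proof -
    have "disjoint_family_on B {..<n}"
      using disj disjoint_family_on_mono by blast
    then have "(LINT x:(\<Union>i<n. B i)|lebesgue. f x) = (\<Sum>i<n. LINT x:B i|lebesgue. f x)"
      using int meas by (intro set_integral_finite_Union) auto
    then show ?thesis
      using eq meas by (metis (no_types, lifting) UN_upper UNIV_I sum.cong)
  qed
  moreover have "(\<lambda>n. LINT x:(\<Union>i<n. B i)|lebesgue. f x) \<longlonglongrightarrow> (LINT x:(\<Union>n. \<Union>i<n. B i)|lebesgue. f x)"
  proof (rule set_integral_cont_up)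
    show "incseq (\<lambda>n. \<Union>i<n. B i)"
      by (intro monoI UN_mono) auto
  qed (use meas f UN in auto)
  ultimately show ?thesis
    using eq[of "\<Union>i. B i"] meas by (simp add: sums_def UN)
qed

text \<open>The area of the unit sphere in the stereographic coordinate, by the layer-cake principle.  The density
at distance \<open>sqrt s\<close> from the origin is the integral of \<open>8 / (1 + u)^3\<close> over \<open>u \<ge> s\<close>.
Exchanging the two integrals leaves the area \<open>pi * u\<close> of a disc, and a one-dimensional integral with an
elementary antiderivative.\<close>

lemma nn_integral_spherical_density:
  "(\<integral>\<^sup>+z. ennreal (4 / (1 + (cmod z)\<^sup>2)\<^sup>2) \<partial>lborel) = ennreal (4 * pi)"
proof -
  have layer: "ennreal (4 / (1 + s)\<^sup>2) = (\<integral>\<^sup>+u. ennreal (8 / (1 + u)^3) * indicator {s..} u \<partial>lborel)"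
    if "0 \<le> s" for s :: real
  proof -
    have "(\<integral>\<^sup>+u. ennreal (8 / (1 + u)^3) * indicator {s..} u \<partial>lborel) = ennreal (0 - (- 4 / (1 + s)\<^sup>2))"
    proof (rule nn_integral_FTC_atLeast)
      show "((\<lambda>u::real. - 4 / (1 + u)\<^sup>2) has_real_derivative 8 / (1 + u)^3) (at u)" if "s \<le> u" for u
      proof -
        have "1 + u \<noteq> 0"
          using that \<open>0 \<le> s\<close> by simp
        moreover have "8 / w^3 = - (- 4 * (2 * w)) / (w\<^sup>2)\<^sup>2" if "w \<noteq> 0" for w :: real
          using that by (simp add: field_simps eval_nat_numeral)
        ultimately show ?thesis
          by (auto intro!: derivative_eq_intros) (simp add: divide_simps)
      qed
      show "((\<lambda>u::real. - 4 / (1 + u)\<^sup>2) \<longlongrightarrow> 0) at_top"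
        by (intro real_tendsto_divide_at_top tendsto_const filterlim_pow_at_top
            filterlim_tendsto_add_at_top[OF tendsto_const] filterlim_ident) auto
    qed (use that in auto)
    then show ?thesis by simp
  qed
  have disc: "(\<integral>\<^sup>+z. indicator {(cmod z)\<^sup>2..} u \<partial>lborel) = ennreal (pi * u) * indicator {0..} u" for u
  proof (cases "0 \<le> u")
    case True
    have "indicator {(cmod z)\<^sup>2..} u = (indicator (cball 0 (sqrt u)) z :: ennreal)" for z :: complex
      using real_sqrt_le_iff[of "(cmod z)\<^sup>2" u] by (simp add: indicator_def)
    then show ?thesis
      using True emeasure_cball[of "sqrt u" "0::complex"] by (simp add: unit_ball_vol_2)
  next
    case False
    then have "indicator {(cmod z)\<^sup>2..} u = (0::ennreal)" for z
      using order_trans[OF zero_le_power2[of "cmod z"], of u] by (auto simp: indicator_def)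
    then show ?thesis using False by simp
  qed
  have "(\<integral>\<^sup>+z. ennreal (4 / (1 + (cmod z)\<^sup>2)\<^sup>2) \<partial>lborel)
      = (\<integral>\<^sup>+z. \<integral>\<^sup>+u. ennreal (8 / (1 + u)^3) * indicator {(cmod z)\<^sup>2..} u \<partial>lborel \<partial>lborel)"
    by (simp add: layer)
  also have "\<dots> = (\<integral>\<^sup>+u. \<integral>\<^sup>+z. ennreal (8 / (1 + u)^3) * indicator {(cmod z)\<^sup>2..} u \<partial>lborel \<partial>lborel)"
  proof (rule lborel_pair.Fubini'[symmetric])
    have "(\<lambda>(z, u). ennreal (8 / (1 + u)^3) * indicator {(cmod z)\<^sup>2..} u) =
        (\<lambda>p. ennreal (8 / (1 + snd p)^3) * (if (cmod (fst p))\<^sup>2 \<le> snd p then 1 else 0))"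
      by (auto simp: indicator_def fun_eq_iff)
    then show "(\<lambda>(z, u). ennreal (8 / (1 + u)^3) * indicator {(cmod z)\<^sup>2..} u)
        \<in> borel_measurable (lborel \<Otimes>\<^sub>M lborel)"
      by simp
  qed
  also have "\<dots> = (\<integral>\<^sup>+u. ennreal (8 / (1 + u)^3) * (ennreal (pi * u) * indicator {0..} u) \<partial>lborel)"
  proof (rule nn_integral_cong)
    fix u :: real
    have "(\<lambda>z. indicator {(cmod z)\<^sup>2..} u :: ennreal) = (\<lambda>z. if (cmod z)\<^sup>2 \<le> u then 1 else 0)"
      by (auto simp: indicator_def)
    then have "(\<lambda>z. indicator {(cmod z)\<^sup>2..} u :: ennreal) \<in> borel_measurable lborel"
      by simp
    then show "(\<integral>\<^sup>+z. ennreal (8 / (1 + u)^3) * indicator {(cmod z)\<^sup>2..} u \<partial>lborel)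
        = ennreal (8 / (1 + u)^3) * (ennreal (pi * u) * indicator {0..} u)"
      by (simp add: nn_integral_cmult disc)
  qed
  also have "\<dots> = (\<integral>\<^sup>+u. ennreal (8 * pi * u / (1 + u)^3) * indicator {0..} u \<partial>lborel)"
    by (intro nn_integral_cong) (auto simp: indicator_def simp flip: ennreal_mult)
  also have "\<dots> = ennreal (0 - 8 * pi * (1 / (2 * (1 + 0)\<^sup>2) - 1 / (1 + 0)))"
  proof (rule nn_integral_FTC_atLeast)
    show "((\<lambda>u::real. 8 * pi * (1 / (2 * (1 + u)\<^sup>2) - 1 / (1 + u))) has_real_derivative 8 * pi * u / (1 + u)^3) (at u)"
      if "0 \<le> u" for u
    proof -
      have "(w - 1) / w^3 = - (2 * (2 * w)) / (2 * w\<^sup>2)\<^sup>2 + 1 / w\<^sup>2" if "w \<noteq> 0" for w :: real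
        using that by (simp add: field_simps eval_nat_numeral)
      from this[of "1 + u"] that
      have "8 * pi * u / (1 + u)^3
          = 8 * pi * (- (2 * (2 * (1 + u))) / (2 * (1 + u)\<^sup>2)\<^sup>2 + 1 / (1 + u)\<^sup>2)"
        by (simp flip: times_divide_eq_right)
      moreover have "((\<lambda>u. 8 * pi * (1 / (2 * (1 + u)\<^sup>2) - 1 / (1 + u))) has_real_derivative
          8 * pi * (- (2 * (2 * (1 + u))) / (2 * (1 + u)\<^sup>2)\<^sup>2 + 1 / (1 + u)\<^sup>2)) (at u)"
        using that by (auto intro!: derivative_eq_intros simp: power2_eq_square)
      ultimately show ?thesis by simp
    qed
    have "((\<lambda>u::real. 8 * pi * (1 / (2 * (1 + u)\<^sup>2) - 1 / (1 + u))) \<longlongrightarrow> 8 * pi * (0 - 0)) at_top"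
      by (intro tendsto_mult tendsto_diff real_tendsto_divide_at_top tendsto_const filterlim_pow_at_top
            filterlim_tendsto_pos_mult_at_top[OF tendsto_const]
            filterlim_tendsto_add_at_top[OF tendsto_const] filterlim_ident) auto
    then show "((\<lambda>u::real. 8 * pi * (1 / (2 * (1 + u)\<^sup>2) - 1 / (1 + u))) \<longlongrightarrow> 0) at_top" by simp
  qed auto
  also have "\<dots> = ennreal (4 * pi)" by simp
  finally show ?thesis .
qed

lemma spherical_density_has_integral:
  "((\<lambda>z. 4 / (1 + (cmod z)\<^sup>2)\<^sup>2) has_integral 4 * pi) UNIV"
  by (rule nn_integral_has_integral[OF _ _ nn_integral_spherical_density]) auto


section \<open>Total curvature\<close>

text \<open>Substitution \<open>z = \<xi> \<nu>\<close> in a single piece.  The orientation condition makes the Jacobian positive, so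
the absolute value in the substitution rule does not change the form.\<close>

lemma oriented_param_integral:
  assumes par: "oriented_param \<Sigma> D \<xi> F" and A: "A \<subseteq> D" "A \<in> sets lebesgue" and inj: "inj_on \<xi> A"
    and nonfocal: "\<forall>\<gamma>\<in>\<Sigma>. nonfocal \<Sigma> \<gamma> (r \<gamma>)"
  defines "\<omega> \<equiv> \<lambda>\<nu>. curvature \<xi> F \<nu> (r (line_of (\<xi> \<nu>) (F \<nu>)))
                * dmu \<xi> F \<nu> (r (line_of (\<xi> \<nu>) (F \<nu>))) 1 \<i>"
  shows "\<xi> ` A \<in> sets lebesgue"
    and "\<nu> \<in> A \<Longrightarrow> 0 \<le> \<omega> \<nu>"
    and "\<omega> absolutely_integrable_on A"
    and "integral A \<omega> = integral (\<xi> ` A) (\<lambda>z. 4 / (1 + (cmod z)\<^sup>2)\<^sup>2)"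
proof -
  define X where "X \<nu> = frechet_derivative \<xi> (at \<nu>)" for \<nu>
  let ?f = "\<lambda>z. 4 / (1 + (cmod z)\<^sup>2)\<^sup>2"
  have "Ck_on (Suc 0) D \<xi>" "Ck_on (Suc 0) D F"
    using par unfolding oriented_param_def smooth_on_def by blast+
  then have diff: "\<xi> differentiable (at \<nu>)" "F differentiable (at \<nu>)" if "\<nu> \<in> A" for \<nu>
    using that A(1) by auto
  have X: "(\<xi> has_derivative X \<nu>) (at \<nu>)" if "\<nu> \<in> A" for \<nu>
    using diff(1)[OF that] by (simp add: X_def frechet_derivative_works)
  have pos: "Im (cnj (X \<nu> 1) * X \<nu> \<i>) > 0" if "\<nu> \<in> A" for \<nu>
    unfolding jacobian_wirtinger[OF X[OF that]] using par A(1) that by (auto simp: oriented_param_def)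
  have \<omega>: "\<omega> \<nu> = \<bar>Im (cnj (X \<nu> 1) * X \<nu> \<i>)\<bar> * ?f (\<xi> \<nu>)" if "\<nu> \<in> A" for \<nu>
  proof -
    have "Delta \<xi> F \<nu> (r (line_of (\<xi> \<nu>) (F \<nu>))) \<noteq> 0"
      using nonfocal par A(1) that
      unfolding nonfocal_def oriented_param_def by blast
    from curvature_times_dmu[OF diff[OF that] this] show ?thesis
      unfolding abs_of_pos[OF pos[OF that]] unfolding \<omega>_def jacobian_wirtinger[OF X[OF that]]
        stereo_factor_def .
  qed
  show "0 \<le> \<omega> \<nu>" if "\<nu> \<in> A"
    unfolding \<omega>[OF that] by simp
  have "\<xi> differentiable_on A"
    using diff(1) by (auto intro: differentiable_at_imp_differentiable_on)
  then show B: "\<xi> ` A \<in> sets lebesgue"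
    by (intro differentiable_image_in_sets_lebesgue A(2)) auto
  have "?f absolutely_integrable_on UNIV"
    using spherical_density_has_integral by (intro nonnegative_absolutely_integrable_1) auto
  then have f: "?f absolutely_integrable_on (\<xi> ` A)"
    by (rule set_integrable_subset) (use B in auto)
  have X_within: "(\<xi> has_derivative X \<nu>) (at \<nu> within A)" if "\<nu> \<in> A" for \<nu>
    using X[OF that] by (rule has_derivative_at_withinI)
  have cov: "(\<lambda>\<nu>. \<bar>Im (cnj (X \<nu> 1) * X \<nu> \<i>)\<bar> * ?f (\<xi> \<nu>)) absolutely_integrable_on A"
    "integral A (\<lambda>\<nu>. \<bar>Im (cnj (X \<nu> 1) * X \<nu> \<i>)\<bar> * ?f (\<xi> \<nu>)) = integral (\<xi> ` A) ?f"
    using complex_change_of_variables[OF A(2) X_within inj f] by blast+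
  show "\<omega> absolutely_integrable_on A"
    using cov(1) by (subst set_integrable_cong[OF refl refl \<omega>]) auto
  show "integral A \<omega> = integral (\<xi> ` A) ?f"
    unfolding cov(2)[symmetric] using \<omega> by (rule integral_cong)
qed

theorem theorem2:
  fixes \<Sigma> :: "line set" and r :: "line \<Rightarrow> real"
  assumes "globally_convex \<Sigma>"
    and "\<And>\<gamma>. \<gamma> \<in> \<Sigma> \<Longrightarrow> nonfocal \<Sigma> \<gamma> (r \<gamma>)"
  shows "has_form_integral \<Sigma>
    (\<lambda>\<xi> F \<nu> h k. curvature \<xi> F \<nu> (r (line_of (\<xi> \<nu>) (F \<nu>)))
                * dmu \<xi> F \<nu> (r (line_of (\<xi> \<nu>) (F \<nu>))) h k)
    (4 * pi)"
proof -
  obtain s where s: "smooth_map_on (sphere 0 1) s"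
      "\<And>W. W \<in> sphere 0 1 \<Longrightarrow> (s W, W) \<in> oriented_lines"
    and \<Sigma>: "\<Sigma> = (\<lambda>W. (s W, W)) ` sphere 0 1"
    using assms(1) unfolding globally_convex_def by blast
  define F0 where "F0 \<xi> = foot_coord (s (line_direction \<xi>)) \<xi>" for \<xi>
  have F0: "line_of \<xi> (F0 \<xi>) = (s (line_direction \<xi>), line_direction \<xi>)" for \<xi>
    unfolding F0_def by (rule global_stereographic_param(1)[OF s \<Sigma>])
  have par0: "oriented_param \<Sigma> UNIV (\<lambda>\<nu>. \<nu>) F0"
    unfolding F0_def by (rule global_stereographic_param(2)[OF s \<Sigma>])
  have cover: "range (\<lambda>\<xi>. line_of \<xi> (F0 \<xi>)) = {\<gamma> \<in> \<Sigma>. snd \<gamma> \<noteq> south_pole}"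
  proof (intro equalityI subsetI)
    fix \<gamma> assume "\<gamma> \<in> {\<gamma> \<in> \<Sigma>. snd \<gamma> \<noteq> south_pole}"
    then obtain W where W: "norm W = 1" "\<gamma> = (s W, W)" "W \<noteq> south_pole"
      by (auto simp: \<Sigma>)
    then show "\<gamma> \<in> range (\<lambda>\<xi>. line_of \<xi> (F0 \<xi>))"
      using line_direction_surj[OF W(1,3)] F0 by (metis rangeI)
  qed (auto simp: F0 \<Sigma> norm_line_direction line_direction_neq_south_pole)
  have "parametrised_partition \<Sigma> (\<lambda>_. UNIV) (\<lambda>_ \<nu>. \<nu>) (\<lambda>_. F0) (\<lambda>i. if i = 0 then UNIV else {})"
    unfolding parametrised_partition_def
  proof (intro conjI)
    show "disjoint_family (\<lambda>i :: nat. (\<lambda>\<nu>. line_of \<nu> (F0 \<nu>)) ` (if i = 0 then UNIV else {}))"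
      by (auto simp: disjoint_family_on_def)
    show "(\<Union>i :: nat. (\<lambda>\<nu>. line_of \<nu> (F0 \<nu>)) ` (if i = 0 then UNIV else {}))
        = {\<gamma> \<in> \<Sigma>. snd \<gamma> \<noteq> south_pole}"
    proof -
      have "(\<Union>i :: nat. g ` (if i = 0 then UNIV else {})) = range g" for g :: "complex \<Rightarrow> line"
        by (auto split: if_splits intro: UN_I[of 0])
      then show ?thesis unfolding cover[symmetric] .
    qed
  qed (use par0 in auto)
  moreover have "(\<forall>i. (\<lambda>\<nu>. curvature (\<xi> i) (F i) \<nu> (r (line_of (\<xi> i \<nu>) (F i \<nu>)))
                * dmu (\<xi> i) (F i) \<nu> (r (line_of (\<xi> i \<nu>) (F i \<nu>))) 1 \<i>) absolutely_integrable_on A i) \<and>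
        summable (\<lambda>i. integral (A i) (\<lambda>\<nu>. \<bar>curvature (\<xi> i) (F i) \<nu> (r (line_of (\<xi> i \<nu>) (F i \<nu>)))
                * dmu (\<xi> i) (F i) \<nu> (r (line_of (\<xi> i \<nu>) (F i \<nu>))) 1 \<i>\<bar>)) \<and>
        (\<lambda>i. integral (A i) (\<lambda>\<nu>. curvature (\<xi> i) (F i) \<nu> (r (line_of (\<xi> i \<nu>) (F i \<nu>)))
                * dmu (\<xi> i) (F i) \<nu> (r (line_of (\<xi> i \<nu>) (F i \<nu>))) 1 \<i>)) sums (4 * pi)"
    (is "(\<forall>i. ?\<omega> i absolutely_integrable_on A i) \<and> _")
    if part: "parametrised_partition \<Sigma> D \<xi> F A" for D \<xi> F A
  proof -
    let ?f = "\<lambda>z. 4 / (1 + (cmod z)\<^sup>2)\<^sup>2"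
    have par: "oriented_param \<Sigma> (D i) (\<xi> i) (F i)" and A: "A i \<subseteq> D i" "A i \<in> sets lebesgue" for i
      using part unfolding parametrised_partition_def by auto
    have line: "line_of (\<xi> i \<nu>) (F i \<nu>) = (s (line_direction (\<xi> i \<nu>)), line_direction (\<xi> i \<nu>))"
      if "\<nu> \<in> A i" for i \<nu>
      using par[of i] A(1)[of i] that by (auto simp: oriented_param_def \<Sigma> line_of_def)
    \<comment> \<open>A line of the graph is determined by its direction, so the parameter \<open>\<xi> i \<nu>\<close> determines
      the line, and disjoint pieces have disjoint sets of directions.\<close>
    have inj: "inj_on (\<xi> i) (A i)" for i
    proof (rule inj_onI)
      fix \<nu> \<mu> assume *: "\<nu> \<in> A i" "\<mu> \<in> A i" "\<xi> i \<nu> = \<xi> i \<mu>"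
      then have "line_of (\<xi> i \<nu>) (F i \<nu>) = line_of (\<xi> i \<mu>) (F i \<mu>)"
        using line[OF *(1)] line[OF *(2)] by metis
      then show "\<nu> = \<mu>"
        using par[of i] A(1)[of i] *(1,2) unfolding oriented_param_def inj_on_def by blast
    qed
    have disj: "disjoint_family (\<lambda>i. \<xi> i ` A i)"
      unfolding disjoint_family_on_def
    proof (intro ballI impI, rule ccontr)
      fix i j :: nat
      assume "i \<noteq> j" "\<xi> i ` A i \<inter> \<xi> j ` A j \<noteq> {}"
      then obtain \<nu> \<mu> where *: "\<nu> \<in> A i" "\<mu> \<in> A j" "\<xi> i \<nu> = \<xi> j \<mu>"
        by auto
      then have "line_of (\<xi> i \<nu>) (F i \<nu>) = line_of (\<xi> j \<mu>) (F j \<mu>)"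
        using line[OF *(1)] line[OF *(2)] by metis
      then have "(\<lambda>\<nu>. line_of (\<xi> i \<nu>) (F i \<nu>)) ` A i \<inter> (\<lambda>\<nu>. line_of (\<xi> j \<nu>) (F j \<nu>)) ` A j \<noteq> {}"
        using *(1,2) by blast
      then show False
        using part \<open>i \<noteq> j\<close> unfolding parametrised_partition_def disjoint_family_on_def by blast
    qed
    have Un: "(\<Union>i. \<xi> i ` A i) = UNIV"
    proof -
      have "z \<in> (\<Union>i. \<xi> i ` A i)" for z
      proof -
        have "line_of z (F0 z) \<in> (\<Union>i. (\<lambda>\<nu>. line_of (\<xi> i \<nu>) (F i \<nu>)) ` A i)"
        proof -
          have "(\<Union>i. (\<lambda>\<nu>. line_of (\<xi> i \<nu>) (F i \<nu>)) ` A i) = range (\<lambda>\<xi>. line_of \<xi> (F0 \<xi>))"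
            using part unfolding parametrised_partition_def cover by (elim conjE)
          then show ?thesis by simp
        qed
        then obtain i \<nu> where "\<nu> \<in> A i" "line_of (\<xi> i \<nu>) (F i \<nu>) = line_of z (F0 z)"
          by auto
        moreover from this have "line_direction (\<xi> i \<nu>) = line_direction z"
          by (simp add: line F0)
        then have "\<xi> i \<nu> = z"
          by (rule injD[OF inj_line_direction])
        ultimately show ?thesis by blast
      qed
      then show ?thesis by auto
    qed
    have "\<forall>\<gamma>\<in>\<Sigma>. nonfocal \<Sigma> \<gamma> (r \<gamma>)"
      using assms(2) by blast
    note int = oriented_param_integral[OF par A inj this]
    have abs: "integral (A i) (\<lambda>\<nu>. \<bar>?\<omega> i \<nu>\<bar>) = integral (A i) (?\<omega> i)" for i
      by (intro integral_cong abs_of_nonneg int(2))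
    have "?f absolutely_integrable_on (\<Union>i. \<xi> i ` A i)"
      unfolding Un
      using spherical_density_has_integral by (intro nonnegative_absolutely_integrable_1) auto
    from integral_sums_disjoint[OF int(1) disj this]
    have sums: "(\<lambda>i. integral (A i) (?\<omega> i)) sums (4 * pi)"
      unfolding int(4) Un integral_unique[OF spherical_density_has_integral] .
    show ?thesis
      unfolding abs using int(3) sums sums_summable by blast
  qed
  ultimately show ?thesis
    unfolding has_form_integral_def by blast
qed

end
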